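(* Let $G$ be the Heisenberg group of dimension $2n+1$, $H$ a non-trivial connected closed subgroup of $G$, and $D=G^{\mathbb{C}}/H^{\mathbb{C}}$. Then the continuous representation $(\pi,\mathcal{O}(D))$ of $G$, defined by $[\pi(g)f](x)=f(g^{-1}\cdot x)$ for $g\in G$, $f\in\mathcal{O}(D)$, $x\in D$, is multiplicity-free. Moreover, if $L$ is a connected closed subgroup of $G$ such that the $L$-action on $G^{\mathbb{C}}/H^{\mathbb{C}}$ is strongly visible, then the restriction $\pi|_L$ of $\pi$ to $L$ is still multiplicity-free.
   Context: Let $n\ge 1$. The Heisenberg Lie algebra $\mathfrak{g}$ has basis $X_1,\dots,X_n,Y_1,\dots,Y_n,Z$ with $[X_i,Y_j]=\delta_{ij}Z$ and all other brackets of basis elements zero; $G=\mathbf{H}_n=\exp\mathfrak{g}$ is the connected, simply connected Heisenberg group. A connected closed subgroup is $H=\exp\mathfrak{h}$ for a subalgebra $\mathfrak{h}$; non-trivial means $H\neq\{e\}$, $H\ne G$. $G^{\mathbb{C}}=\exp\mathfrak{g}^{\mathbb{C}}$ is the simply connected complex Lie group with Lie algebra the complexification $\mathfrak{g}^{\mathbb{C}}$, $H^{\mathbb{C}}=\exp\mathfrak{h}^{\mathbb{C}}$, and $G$ and its subgroups act on $D$ by left translation. $\mathcal{O}(D)$ is the space of holomorphic functions on $D$ with the Fréchet topology of uniform convergence on compact sets. Multiplicity-freeness: a unitary representation of a Lie group $L$ on a Hilbert space is multiplicity-free if its algebra of bounded $L$-intertwining endomorphisms is commutative. A unitary representation of $L$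 on a Hilbert space $\mathcal{H}$ is realized in $\mathcal{O}(D)$ if there is an injective continuous $L$-intertwining linear map $\mathcal{H}\to\mathcal{O}(D)$. The continuous representation of $L$ on $\mathcal{O}(D)$ is called multiplicity-free if every unitary representation of $L$ realized in $\mathcal{O}(D)$ is multiplicity-free. Strong visibility: a holomorphic action of a Lie group $L$ on a connected complex manifold $D$ is called strongly visible if there exist a real submanifold $S$ in $D$ and an anti-holomorphic diffeomorphism $\sigma$ of $D$ such that: (V.0) $D':=L\cdot S$ is a non-empty open set in $D$; (S.1) $\sigma|_S=\operatorname{id}_S$; (S.2) $\sigma$ preserves each $L$-orbit in $D'$. *)

theory Defs
  imports "HOL-Analysis.Analysis" "HOL-Algebra.Left_Coset"
begin

datatype 'n heis_index = Xi 'n | Yi 'n | Zi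

lemma UNIV_heis_index: "(UNIV :: 'n heis_index set) = range Xi \<union> range Yi \<union> {Zi}"
proof -
  have "i \<in> range Xi \<union> range Yi \<union> {Zi}" for i :: "'n heis_index"
    by (cases i) auto
  then show ?thesis
    by blast
qed

instance heis_index :: (finite) finite
  by standard (simp add: UNIV_heis_index)

text \<open>
  The Heisenberg Lie algebra over \<open>'k\<close> with \<open>n = CARD('n)\<close>; its basis vectors
  \<open>X\<^sub>i\<close>, \<open>Y\<^sub>i\<close>, \<open>Z\<close> are \<open>axis (Xi i) 1\<close>, \<open>axis (Yi i) 1\<close>, \<open>axis Zi 1\<close>.
\<close>

type_synonym ('k, 'n) heis = "'k ^ 'n heis_index"

definition heis_bracket :: "('k::field, 'n::finite) heis \<Rightarrow> ('k, 'n) heis \<Rightarrow> ('k, 'n) heis" where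
  "heis_bracket u v = (\<Sum>i\<in>UNIV. u $ Xi i * v $ Yi i - u $ Yi i * v $ Xi i) *s axis Zi 1"

text \<open>
  The simply connected group in exponential coordinates: the vector \<open>u\<close> stands for the group
  element \<open>exp u\<close>, and the product is given by the Baker--Campbell--Hausdorff formula, which
  stops at the first bracket because the algebra is two-step nilpotent.  In these coordinates
  the one-parameter subgroup \<open>t \<mapsto> exp (t u)\<close> is \<open>t \<mapsto> t u\<close>.
\<close>

definition heis_group :: "('k::field, 'n::finite) heis monoid" where
  "heis_group = \<lparr>carrier = UNIV,
     mult = (\<lambda>u v. u + v + (1 / 2) *s heis_bracket u v), one = 0\<rparr>"

lemma group_heis_group: "group (heis_group :: ('k::field, 'n::finite) heis monoid)"
proof (rule groupI)
  fix u v w :: "('k, 'n) heis"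
  show "u \<otimes>\<^bsub>heis_group\<^esub> v \<otimes>\<^bsub>heis_group\<^esub> w = u \<otimes>\<^bsub>heis_group\<^esub> (v \<otimes>\<^bsub>heis_group\<^esub> w)"
  proof -
    have *: "heis_bracket (u + v) w = heis_bracket u w + heis_bracket v w"
        "heis_bracket u (v + w) = heis_bracket u v + heis_bracket u w" for u v w :: "('k, 'n) heis"
      by (auto simp: heis_bracket_def vec_eq_iff algebra_simps sum.distrib sum_subtractf)
    have **: "heis_bracket (c *s heis_bracket u v) w = 0"
        "heis_bracket w (c *s heis_bracket u v) = 0" for u v w :: "('k, 'n) heis" and c
      by (auto simp: heis_bracket_def axis_def)
    show ?thesis
      by (simp add: heis_group_def * ** vec.scale_right_distrib)
  qed
  show "\<exists>y\<in>carrier heis_group. y \<otimes>\<^bsub>heis_group\<^esub> u = \<one>\<^bsub>heis_group\<^esub>"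
    by (rule bexI[of _ "- u"]) (auto simp: heis_group_def heis_bracket_def)
qed (auto simp: heis_group_def heis_bracket_def)

abbreviation real_heis :: "(real, 'n::finite) heis monoid" where
  "real_heis \<equiv> heis_group"

abbreviation complex_heis :: "(complex, 'n::finite) heis monoid" where
  "complex_heis \<equiv> heis_group"

definition complexify :: "(real, 'n::finite) heis \<Rightarrow> (complex, 'n) heis" where
  "complexify u = (\<chi> i. complex_of_real (u $ i))"

definition connected_closed_subgroup :: "(real, 'n::finite) heis set \<Rightarrow> bool" where
  "connected_closed_subgroup H \<longleftrightarrow> subgroup H real_heis \<and> closed H \<and> connected H"

definition lie_algebra_of :: "(real, 'n::finite) heis set \<Rightarrow> (real, 'n) heis set" where
  "lie_algebra_of H = {u. \<forall>t. t *\<^sub>R u \<in> H}"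

text \<open>\<open>H\<^sup>\<complex> = exp (\<hh> \<otimes> \<complex>)\<close>, the complexified Lie algebra being the complex span of \<open>\<hh>\<close>.\<close>

definition complex_subgroup :: "(real, 'n::finite) heis set \<Rightarrow> (complex, 'n) heis set" where
  "complex_subgroup H = vec.span (complexify ` lie_algebra_of H)"

type_synonym 'n hpoint = "(complex, 'n) heis set"

definition hspace :: "(real, 'n::finite) heis set \<Rightarrow> 'n hpoint set" where
  "hspace H = lcosets\<^bsub>complex_heis\<^esub> (complex_subgroup H)"

definition hproj :: "(real, 'n::finite) heis set \<Rightarrow> (complex, 'n) heis \<Rightarrow> 'n hpoint" where
  "hproj H x = x <#\<^bsub>complex_heis\<^esub> complex_subgroup H"

definition translate :: "(real, 'n::finite) heis \<Rightarrow> 'n hpoint \<Rightarrow> 'n hpoint" where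
  "translate g p = complexify g <#\<^bsub>complex_heis\<^esub> p"

definition hspace_topology :: "(real, 'n::finite) heis set \<Rightarrow> 'n hpoint topology" where
  "hspace_topology H = topology (\<lambda>U. U \<subseteq> hspace H \<and> open (hproj H -` U))"

lemma openin_hspace_topology:
  "openin (hspace_topology H) U \<longleftrightarrow> U \<subseteq> hspace H \<and> open (hproj H -` U)"
proof -
  have "istopology (\<lambda>U. U \<subseteq> hspace H \<and> open (hproj H -` U))"
    unfolding istopology_def by (auto simp: vimage_Union intro!: open_UN)
  then show ?thesis
    by (simp add: hspace_topology_def topology_inverse')
qed

definition cholomorphic_on :: "(complex ^ 'm \<Rightarrow> complex) \<Rightarrow> (complex ^ 'm::finite) set \<Rightarrow> bool" where
  "cholomorphic_on f A \<longleftrightarrow>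
     (\<forall>x\<in>A. \<exists>f'. (f has_derivative f') (at x) \<and> (\<forall>c v. f' (c *s v) = c * f' v))"

primrec Ck_on :: "nat \<Rightarrow> ('a::real_normed_vector \<Rightarrow> 'b::real_normed_vector) \<Rightarrow> 'a set \<Rightarrow> bool" where
  "Ck_on 0 f A \<longleftrightarrow> continuous_on A f"
| "Ck_on (Suc k) f A \<longleftrightarrow> (\<forall>x\<in>A. f differentiable at x) \<and>
     (\<forall>v. Ck_on k (\<lambda>x. frechet_derivative f (at x) v) A)"

text \<open>
  The manifold structure of the quotient is the one for which the projection is a holomorphic
  submersion.  Hence a function on an open set \<open>U\<close> is holomorphic (smooth) iff its pull-back
  along the projection is.  Functions on \<open>U\<close> are extensional, so that they are determined by their
  values on \<open>U\<close>.
\<close>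

definition hol_functions :: "(real, 'n::finite) heis set \<Rightarrow> 'n hpoint set \<Rightarrow> ('n hpoint \<Rightarrow> complex) set" where
  "hol_functions H U = {f \<in> extensional U. cholomorphic_on (\<lambda>x. f (hproj H x)) (hproj H -` U)}"

definition smooth_functions :: "(real, 'n::finite) heis set \<Rightarrow> 'n hpoint set \<Rightarrow> ('n hpoint \<Rightarrow> real) set" where
  "smooth_functions H U = {f \<in> extensional U. \<forall>k. Ck_on k (\<lambda>x. f (hproj H x)) (hproj H -` U)}"

definition uniform_on_compacts_topology :: "(real, 'n::finite) heis set \<Rightarrow> ('n hpoint \<Rightarrow> complex) topology" where
  "uniform_on_compacts_topology H = topology_generated_by
     {{f \<in> hol_functions H (hspace H). \<forall>p\<in>K. cmod (f p - f0 p) < e} | f0 K e.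
        f0 \<in> hol_functions H (hspace H) \<and> compactin (hspace_topology H) K \<and> 0 < e}"

definition hrep :: "(real, 'n::finite) heis set \<Rightarrow> (real, 'n) heis \<Rightarrow>
    ('n hpoint \<Rightarrow> complex) \<Rightarrow> 'n hpoint \<Rightarrow> complex" where
  "hrep H g f = (\<lambda>p\<in>hspace H. f (translate (inv\<^bsub>real_heis\<^esub> g) p))"

text \<open>
  An embedded real submanifold of codimension \<open>c\<close>: locally the common zero set of \<open>c\<close> smooth real
  functions with linearly independent differentials.  Since the projection is a submersion,
  independence of the differentials may be tested on the pull-backs.
\<close>

definition real_submanifold :: "(real, 'n::finite) heis set \<Rightarrow> 'n hpoint set \<Rightarrow> bool" where
  "real_submanifold H S \<longleftrightarrow> S \<subseteq> hspace H \<and>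
     (\<exists>c. \<forall>p\<in>S. \<exists>U F. openin (hspace_topology H) U \<and> p \<in> U \<and>
        (\<forall>i<c. F i \<in> smooth_functions H U) \<and>
        (\<forall>x\<in>hproj H -` U. \<forall>a :: nat \<Rightarrow> real.
           (\<forall>v. (\<Sum>i<c. a i * frechet_derivative (\<lambda>y. F i (hproj H y)) (at x) v) = 0)
             \<longrightarrow> (\<forall>i<c. a i = 0)) \<and>
        S \<inter> U = {p'\<in>U. \<forall>i<c. F i p' = 0})"

text \<open>
  A continuous map is anti-holomorphic iff the pull-back of every local holomorphic
  function (in particular of every local holomorphic coordinate) is anti-holomorphic.
\<close>

definition antiholomorphic_map :: "(real, 'n::finite) heis set \<Rightarrow> ('n hpoint \<Rightarrow> 'n hpoint) \<Rightarrow> bool" where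
  "antiholomorphic_map H \<sigma> \<longleftrightarrow> continuous_map (hspace_topology H) (hspace_topology H) \<sigma> \<and>
     (\<forall>U f. openin (hspace_topology H) U \<and> f \<in> hol_functions H U \<longrightarrow>
        (\<lambda>p\<in>{p \<in> hspace H. \<sigma> p \<in> U}. cnj (f (\<sigma> p)))
          \<in> hol_functions H {p \<in> hspace H. \<sigma> p \<in> U})"

definition antiholomorphic_diffeo :: "(real, 'n::finite) heis set \<Rightarrow> ('n hpoint \<Rightarrow> 'n hpoint) \<Rightarrow> bool" where
  "antiholomorphic_diffeo H \<sigma> \<longleftrightarrow> bij_betw \<sigma> (hspace H) (hspace H) \<and>
     antiholomorphic_map H \<sigma> \<and> antiholomorphic_map H (inv_into (hspace H) \<sigma>)"

definition orbit_of :: "(real, 'n::finite) heis set \<Rightarrow> 'n hpoint \<Rightarrow> 'n hpoint set" where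
  "orbit_of L p = (\<lambda>g. translate g p) ` L"

definition strongly_visible :: "(real, 'n::finite) heis set \<Rightarrow> (real, 'n) heis set \<Rightarrow> bool" where
  "strongly_visible H L \<longleftrightarrow> (\<exists>S \<sigma>. real_submanifold H S \<and> antiholomorphic_diffeo H \<sigma> \<and>
     (let D' = (\<Union>p\<in>S. orbit_of L p) in
        D' \<noteq> {} \<and> openin (hspace_topology H) D' \<and>
        (\<forall>p\<in>S. \<sigma> p = p) \<and>
        (\<forall>p\<in>D'. \<sigma> ` orbit_of L p \<subseteq> orbit_of L p)))"

class complex_hilbert_space = real_normed_vector + complete_space +
  fixes scaleC :: "complex \<Rightarrow> 'a \<Rightarrow> 'a" (infixr \<open>*\<^sub>C\<close> 75)
    and cinner :: "'a \<Rightarrow> 'a \<Rightarrow> complex"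
  assumes scaleR_scaleC: "scaleR r u = complex_of_real r *\<^sub>C u"
    and scaleC_add_right: "c *\<^sub>C (u + v) = c *\<^sub>C u + c *\<^sub>C v"
    and scaleC_add_left: "(b + c) *\<^sub>C u = b *\<^sub>C u + c *\<^sub>C u"
    and scaleC_scaleC: "b *\<^sub>C c *\<^sub>C u = (b * c) *\<^sub>C u"
    and cinner_commute: "cinner u v = cnj (cinner v u)"
    and cinner_add_left: "cinner (u + v) w = cinner u w + cinner v w"
    and cinner_scaleC_left: "cinner (c *\<^sub>C u) v = c * cinner u v"
    and cinner_self: "cinner u u = complex_of_real ((norm u)\<^sup>2)"

definition bounded_operator :: "('v::complex_hilbert_space \<Rightarrow> 'v) \<Rightarrow> bool" where
  "bounded_operator A \<longleftrightarrow> bounded_linear A \<and> (\<forall>c v. A (c *\<^sub>C v) = c *\<^sub>C A v)"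

definition unitary_operator :: "('v::complex_hilbert_space \<Rightarrow> 'v) \<Rightarrow> bool" where
  "unitary_operator A \<longleftrightarrow> bounded_operator A \<and> surj A \<and> (\<forall>u v. cinner (A u) (A v) = cinner u v)"

definition unitary_rep :: "(real, 'n::finite) heis set \<Rightarrow>
    ((real, 'n) heis \<Rightarrow> 'v::complex_hilbert_space \<Rightarrow> 'v) \<Rightarrow> bool" where
  "unitary_rep L \<tau> \<longleftrightarrow>
     (\<forall>g\<in>L. unitary_operator (\<tau> g)) \<and>
     (\<forall>g\<in>L. \<forall>g'\<in>L. \<tau> (g \<otimes>\<^bsub>real_heis\<^esub> g') = \<tau> g \<circ> \<tau> g') \<and>
     (\<forall>v. continuous_on L (\<lambda>g. \<tau> g v))"

definition intertwining_operators :: "(real, 'n::finite) heis set \<Rightarrow>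
    ((real, 'n) heis \<Rightarrow> 'v::complex_hilbert_space \<Rightarrow> 'v) \<Rightarrow> ('v \<Rightarrow> 'v) set" where
  "intertwining_operators L \<tau> = {A. bounded_operator A \<and> (\<forall>g\<in>L. A \<circ> \<tau> g = \<tau> g \<circ> A)}"

definition multiplicity_free_unitary :: "(real, 'n::finite) heis set \<Rightarrow>
    ((real, 'n) heis \<Rightarrow> 'v::complex_hilbert_space \<Rightarrow> 'v) \<Rightarrow> bool" where
  "multiplicity_free_unitary L \<tau> \<longleftrightarrow>
     (\<forall>A\<in>intertwining_operators L \<tau>. \<forall>B\<in>intertwining_operators L \<tau>. A \<circ> B = B \<circ> A)"

definition realized_in :: "(real, 'n::finite) heis set \<Rightarrow> (real, 'n) heis set \<Rightarrow>
    ((real, 'n) heis \<Rightarrow> ('n hpoint \<Rightarrow> complex) \<Rightarrow> 'n hpoint \<Rightarrow> complex) \<Rightarrow>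
    ((real, 'n) heis \<Rightarrow> 'v::complex_hilbert_space \<Rightarrow> 'v) \<Rightarrow> bool" where
  "realized_in H L \<rho> \<tau> \<longleftrightarrow> (\<exists>\<Phi> :: 'v \<Rightarrow> 'n hpoint \<Rightarrow> complex.
     inj \<Phi> \<and> continuous_map euclidean (uniform_on_compacts_topology H) \<Phi> \<and>
     (\<forall>u v. \<forall>p\<in>hspace H. \<Phi> (u + v) p = \<Phi> u p + \<Phi> v p) \<and>
     (\<forall>c v. \<forall>p\<in>hspace H. \<Phi> (c *\<^sub>C v) p = c * \<Phi> v p) \<and>
     (\<forall>g\<in>L. \<forall>v. \<Phi> (\<tau> g v) = \<rho> g (\<Phi> v)))"

text \<open>
  The representation \<open>\<rho>\<close> of \<open>L\<close> on the holomorphic functions on the homogeneous space of \<open>H\<close> is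
  multiplicity-free as far as representations on the Hilbert space \<open>'v\<close> are concerned.
  HOL cannot quantify over Hilbert spaces inside a formula, so the type \<open>'v\<close> is a parameter, to be
  left as a type variable in theorems.
\<close>

definition multiplicity_free :: "'v::complex_hilbert_space itself \<Rightarrow>
    (real, 'n::finite) heis set \<Rightarrow> (real, 'n) heis set \<Rightarrow>
    ((real, 'n) heis \<Rightarrow> ('n hpoint \<Rightarrow> complex) \<Rightarrow> 'n hpoint \<Rightarrow> complex) \<Rightarrow> bool" where
  "multiplicity_free TYPE('v) H L \<rho> \<longleftrightarrow>
     (\<forall>\<tau> :: (real, 'n) heis \<Rightarrow> 'v \<Rightarrow> 'v.
        unitary_rep L \<tau> \<and> realized_in H L \<rho> \<tau> \<longrightarrow> multiplicity_free_unitary L \<tau>)"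

end

theory Submission
  imports Defs "HOL-Complex_Analysis.Conformal_Mappings"
begin

text \<open>
  The proof is Kobayashi's method of visible actions. Let a unitary representation of \<open>L\<close> be
  realized in the holomorphic functions on \<open>D = G\<^sup>\<complex> / H\<^sup>\<complex>\<close>. By
  continuity of the realization, point evaluations are represented by vectors \<open>e\<^sub>x\<close>, and
  a bounded operator \<open>A\<close> has the kernel \<open>K\<^sub>A(x, y) = \<langle>A e\<^sub>y,
  e\<^sub>x\<rangle>\<close>, which is holomorphic in \<open>x\<close> and anti-holomorphic in
  \<open>y\<close>. If \<open>A\<close> is an intertwiner, its kernel is \<open>L\<close>-invariant. Suppose
  that an anti-holomorphic map \<open>\<sigma>\<close> of \<open>D\<close> onto itself maps each point of
  some nonempty open set into its own \<open>L\<close>-orbit. Then \<open>K\<^sub>A(\<sigma> x, \<sigma> x)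
  = K\<^sub>A(x, x)\<close> there, and since a kernel of this type is determined by its values on the
  diagonal over an open set (\<open>sesquiholomorphic_kernel_eq_0\<close>), \<open>K\<^sub>A(\<sigma> y,
  \<sigma> x) = K\<^sub>A(x, y)\<close> everywhere. For \<open>A = 1\<close> this says that \<open>e\<^sub>x
  \<mapsto> e\<^bsub>\<sigma> x\<^esub>\<close> extends to an antiunitary map \<open>J\<close>, and in
  general it says that conjugation by \<open>J\<close> maps every intertwiner to its adjoint. As conjugation
  preserves the order of products and the adjoint reverses it, intertwiners commute. This is
  \<open>multiplicity_free_if_orbits_preserved\<close>, and the assertion about strongly visible actions is
  a special case.

  For the full group \<open>G\<close> it remains to find such a map \<open>\<sigma>\<close>
  (\<open>exists_orbit_preserving_involution\<close>). The Lie algebra \<open>\<hh>\<close> of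
  \<open>H\<close> is nonzero because \<open>H\<close> is closed, connected and nontrivial. Choose a real
  functional \<open>\<phi>\<close> with \<open>\<phi>(Z) = 1\<close>, which vanishes on \<open>\<hh>\<close>
  unless \<open>Z \<in> \<hh>\<close>. Then \<open>u \<mapsto> - cnj u + 2 \<phi>(cnj u) Z\<close> is an
  antilinear involutive automorphism of \<open>G\<^sup>\<complex>\<close> that preserves
  \<open>H\<^sup>\<complex>\<close>, hence acts on \<open>D\<close>. On the coordinates along the
  \<open>X\<^sub>i\<close> and \<open>Y\<^sub>i\<close> it preserves the imaginary part, so it changes these
  coordinates by a real translation. The central coordinate can then be corrected: by
  \<open>H\<^sup>\<complex>\<close> itself if \<open>Z \<in> \<hh>\<close>, and otherwise, for generic
  points, by moving a real multiple of an element of \<open>\<hh>\<close> from one side to the other, which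
  shifts the imaginary part of the central coordinate.
\<close>

section \<open>Complex Hilbert spaces\<close>

lemma scaleC_one: "1 *\<^sub>C v = v"
  using scaleR_scaleC[of 1 v] by simp

lemma cinner_add_right: "cinner u (v + w) = cinner u v + cinner u w"
  by (metis cinner_add_left cinner_commute complex_cnj_add)

lemma cinner_scaleC_right: "cinner u (c *\<^sub>C v) = cnj c * cinner u v"
  by (metis cinner_scaleC_left cinner_commute complex_cnj_mult)

lemma cinner_scaleR_left: "cinner (r *\<^sub>R u) v = complex_of_real r * cinner u v"
  by (simp add: scaleR_scaleC cinner_scaleC_left)

lemma cinner_scaleR_right: "cinner u (r *\<^sub>R v) = complex_of_real r * cinner u v"
  by (simp add: scaleR_scaleC cinner_scaleC_right)

lemma cinner_zero_left [simp]: "cinner 0 v = 0"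
  using cinner_add_left[of 0 0 v] by simp

lemma cinner_zero_right [simp]: "cinner v 0 = 0"
  using cinner_add_right[of v 0 0] by simp

lemma cinner_minus_left: "cinner (- u) v = - cinner u v"
  using cinner_add_left[of u "- u" v] by (simp add: eq_neg_iff_add_eq_0 add.commute)

lemma cinner_minus_right: "cinner u (- v) = - cinner u v"
  using cinner_add_right[of u v "- v"] by (simp add: eq_neg_iff_add_eq_0 add.commute)

lemma cinner_diff_left: "cinner (u - v) w = cinner u w - cinner v w"
  using cinner_add_left[of u "- v" w] by (simp add: cinner_minus_left)

lemma cinner_diff_right: "cinner u (v - w) = cinner u v - cinner u w"
  using cinner_add_right[of u v "- w"] by (simp add: cinner_minus_right)

lemmas cinner_linear = cinner_add_left cinner_add_right cinner_diff_left cinner_diff_right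
  cinner_scaleC_left cinner_scaleC_right cinner_scaleR_left cinner_scaleR_right

lemma cinner_eq_0_iff [simp]: "cinner u u = 0 \<longleftrightarrow> u = 0"
  by (simp add: cinner_self)

lemma power2_norm_eq_Re_cinner: "(norm u)\<^sup>2 = Re (cinner u u)"
  by (simp add: cinner_self)

lemma Re_cinner_commute: "Re (cinner u v) = Re (cinner v u)"
  by (subst cinner_commute) simp

lemma norm_scaleC: "norm (c *\<^sub>C u) = cmod c * norm u"
proof -
  have "cinner (c *\<^sub>C u) (c *\<^sub>C u) = (c * cnj c) * cinner u u"
    by (simp add: cinner_linear)
  also have "\<dots> = complex_of_real ((cmod c * norm u)\<^sup>2)"
    by (simp only: complex_norm_square[symmetric] cinner_self power_mult_distrib of_real_mult)
  finally have "(norm (c *\<^sub>C u))\<^sup>2 = (cmod c * norm u)\<^sup>2"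
    by (simp only: cinner_self of_real_eq_iff)
  then show ?thesis
    by (simp add: power2_eq_iff_nonneg)
qed

lemma cinner_Cauchy_Schwarz: "cmod (cinner u v) \<le> norm u * norm v"
proof (cases "v = 0")
  case False
  define r where "r = (norm v)\<^sup>2"
  have r: "r > 0"
    using False by (simp add: r_def)
  \<comment> \<open>The vector \<open>c v\<close> is the projection of \<open>u\<close> onto the line through \<open>v\<close>.\<close>
  define c where "c = cinner u v / complex_of_real r"
  have cc: "Re (cnj c * cinner u v) = (cmod (cinner u v))\<^sup>2 / r" 
    unfolding c_def cmod_power2 by (simp add: power2_eq_square add_divide_distrib)
  have "0 \<le> (norm (u - c *\<^sub>C v))\<^sup>2"
    by simp
  also have "(norm (u - c *\<^sub>C v))\<^sup>2 = (norm u)\<^sup>2 - 2 * Re (cnj c * cinner u v) + (cmod c)\<^sup>2 * r"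
  proof -
    have "(norm (u - c *\<^sub>C v))\<^sup>2 =
        Re (cinner u u) - Re (cnj c * cinner u v) - Re (c * cinner v u) + Re (c * cnj c * cinner v v)"
      by (simp add: power2_norm_eq_Re_cinner cinner_linear algebra_simps)
    moreover have "Re (c * cinner v u) = Re (cnj c * cinner u v)"
      by (subst cinner_commute[of v u]) (simp add: algebra_simps)
    moreover have "Re (c * cnj c * cinner v v) = (cmod c)\<^sup>2 * r"
      by (simp only: complex_norm_square[symmetric] cinner_self of_real_mult[symmetric] r_def Re_complex_of_real)
    ultimately show ?thesis
      using power2_norm_eq_Re_cinner[of u] by linarith
  qed
  also have "(cmod c)\<^sup>2 * r = (cmod (cinner u v))\<^sup>2 / r"
    using r by (simp add: c_def norm_divide power_divide power2_eq_square)
  finally have "(cmod (cinner u v))\<^sup>2 / r \<le> (norm u)\<^sup>2"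
    using cc by simp
  then have "(cmod (cinner u v))\<^sup>2 \<le> (norm u * norm v)\<^sup>2"
    using r by (simp add: divide_le_eq power_mult_distrib r_def)
  then show ?thesis
    by (simp add: power2_le_iff_abs_le)
qed simp

lemma bounded_bilinear_cinner: "bounded_bilinear cinner"
proof
  show "\<exists>K. \<forall>u v. cmod (cinner u v) \<le> norm u * norm v * K"
    by (rule exI[of _ 1]) (simp add: cinner_Cauchy_Schwarz)
qed (simp_all add: cinner_linear scaleR_conv_of_real)

lemmas continuous_on_cinner [continuous_intros] = bounded_bilinear.continuous_on[OF bounded_bilinear_cinner]
  
text \<open>
  By the parallelogram law, two nearly closest points of a subspace are close to each other, since their
  midpoint is no closer to \<open>x\<close> than the infimum allows.
\<close>

lemma minimizing_sequence_Cauchy: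
  fixes x :: "'v::complex_hilbert_space"
  assumes M: "subspace M" and D: "\<And>y. y \<in> M \<Longrightarrow> D \<le> (norm (x - y))\<^sup>2"
    and m: "\<And>n. m n \<in> M" "\<And>n. (norm (x - m n))\<^sup>2 < D + inverse (real (Suc n))"
  shows "Cauchy m"
proof (rule metric_CauchyI)
  fix e :: real
  assume e: "0 < e"
  have parallelogram: "(norm (m i - m j))\<^sup>2 \<le> 2 * inverse (real (Suc i)) + 2 * inverse (real (Suc j))" for i j
  proof -
    define y where "y = (1/2) *\<^sub>R (m i + m j)"
    have y: "y \<in> M"
      unfolding y_def using M m(1) by (intro subspace_scale subspace_add)
    have "(norm (m i - m j))\<^sup>2 + 4 * (norm (x - y))\<^sup>2 = 2 * (norm (x - m i))\<^sup>2 + 2 * (norm (x - m j))\<^sup>2"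
      unfolding y_def power2_norm_eq_Re_cinner
      by (simp add: cinner_linear Re_cinner_commute[of "m i" x] Re_cinner_commute[of "m j" x] Re_cinner_commute[of "m j" "m i"] algebra_simps)
    with D[OF y] m(2)[of i] m(2)[of j] show ?thesis
      by linarith
  qed
  obtain N where N: "inverse (real (Suc N)) < e\<^sup>2 / 4"
    using reals_Archimedean[of "e\<^sup>2 / 4"] e by auto
  have "dist (m i) (m j) < e" if "N \<le> i" "N \<le> j" for i j
  proof -
    have "inverse (real (Suc i)) \<le> inverse (real (Suc N))" "inverse (real (Suc j)) \<le> inverse (real (Suc N))"
      using that by (auto simp: field_simps)
    then have "(norm (m i - m j))\<^sup>2 < e\<^sup>2"
      using parallelogram[of i j] N by linarith
    then show ?thesis
      using e by (simp add: dist_norm power_less_imp_less_base)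
  qed
  then show "\<exists>N. \<forall>i\<ge>N. \<forall>j\<ge>N. dist (m i) (m j) < e"
    by blast
qed

text \<open>
  Orthogonality is taken with respect to the real part of the inner product, so that the lemma covers real
  subspaces such as the projection of the graph of an antilinear map.
\<close>

lemma orthogonal_projection_exists:
  fixes x :: "'v::complex_hilbert_space"
  assumes M: "subspace M" "closed M"
  obtains m where "m \<in> M" "\<And>y. y \<in> M \<Longrightarrow> Re (cinner (x - m) y) = 0"
proof -
  define D where "D = (INF y\<in>M. (norm (x - y))\<^sup>2)"
  have D: "D \<le> (norm (x - y))\<^sup>2" if "y \<in> M" for y
    unfolding D_def using that by (intro cINF_lower bdd_belowI2[of _ 0]) auto
  have "\<exists>y\<in>M. (norm (x - y))\<^sup>2 < D + inverse (real (Suc n))" for n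
  proof -
    have "(\<lambda>y. (norm (x - y))\<^sup>2) ` M \<noteq> {}"
      using subspace_0[OF M(1)] by blast
    from cInf_lessD[OF this, of "D + inverse (real (Suc n))"] show ?thesis
      by (auto simp: D_def)
  qed
  then obtain s where s: "\<And>n. s n \<in> M" "\<And>n. (norm (x - s n))\<^sup>2 < D + inverse (real (Suc n))"
    by metis
  have "Cauchy s"
    using minimizing_sequence_Cauchy[OF M(1) D s] .
  then obtain m where lim: "s \<longlonglongrightarrow> m"
    using Cauchy_convergent convergent_def by blast
  have m: "m \<in> M"
    using closed_sequentially[OF M(2) _ lim] s(1) by blast
  have "(\<lambda>n. (norm (x - s n))\<^sup>2) \<longlonglongrightarrow> (norm (x - m))\<^sup>2"
    by (intro tendsto_intros lim)
  moreover have "(\<lambda>n. D + inverse (real (Suc n))) \<longlonglongrightarrow> D + 0"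
    by (intro tendsto_intros LIMSEQ_inverse_real_of_nat)
  ultimately have min: "(norm (x - m))\<^sup>2 \<le> D"
    using s(2) by (force intro: LIMSEQ_le less_imp_le)
  have "Re (cinner (x - m) y) = 0" if y: "y \<in> M" for y
  proof (cases "y = 0")
    case False
    \<comment> \<open>This \<open>t\<close> minimizes the distance from \<open>x\<close> to \<open>m + t y\<close>.\<close>
    define t where "t = Re (cinner (x - m) y) / (norm y)\<^sup>2"
    have "m + t *\<^sub>R y \<in> M"
      using M(1) m y by (intro subspace_add subspace_scale)
    from D[OF this] min have "(norm (x - m))\<^sup>2 \<le> (norm ((x - m) - t *\<^sub>R y))\<^sup>2"
      unfolding diff_diff_eq by linarith
    also have "\<dots> = (norm (x - m))\<^sup>2 - 2 * t * Re (cinner (x - m) y) + t * t * (norm y)\<^sup>2"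
      unfolding power2_norm_eq_Re_cinner
      by (simp add: cinner_linear Re_cinner_commute[of y x] Re_cinner_commute[of y m] algebra_simps)
    also have "t * t * (norm y)\<^sup>2 = t * Re (cinner (x - m) y)"
    proof -
      have "(norm y)\<^sup>2 \<noteq> 0"
        using False by simp
      then have "t * (norm y)\<^sup>2 = Re (cinner (x - m) y)"
        unfolding t_def by simp
      then show ?thesis
        by (simp only: mult.assoc)
    qed
    finally have "t * Re (cinner (x - m) y) \<le> 0"
      by simp
    then have "(Re (cinner (x - m) y))\<^sup>2 / (norm y)\<^sup>2 \<le> 0"
      unfolding t_def power2_eq_square by (simp only: times_divide_eq_left)
    moreover have "(norm y)\<^sup>2 > 0"
      using False by simp
    ultimately have "(Re (cinner (x - m) y))\<^sup>2 \<le> 0"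
      by (simp add: divide_le_0_iff)
    then show ?thesis by simp
  qed simp
  with m show ?thesis
    using that by blast
qed

lemma closed_subspace_eq_UNIV:
  fixes M :: "'v::complex_hilbert_space set"
  assumes "subspace M" "closed M" "\<And>v. (\<And>y. y \<in> M \<Longrightarrow> Re (cinner v y) = 0) \<Longrightarrow> v = 0"
  shows "M = UNIV"
proof -
  have "x \<in> M" for x
  proof -
    obtain m where "m \<in> M" "\<And>y. y \<in> M \<Longrightarrow> Re (cinner (x - m) y) = 0"
      using orthogonal_projection_exists[OF assms(1,2)] by blast
    then show ?thesis
      using assms(3)[of "x - m"] by auto
  qed
  then show ?thesis by blast
qed

lemma closed_subspace_eq_UNIV_of_total:
  fixes M :: "'v::complex_hilbert_space set"
  assumes M: "subspace M" "closed M" and e: "\<And>c x. c *\<^sub>C e x \<in> M"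
    and total: "\<And>v. (\<And>x. cinner v (e x) = 0) \<Longrightarrow> v = 0"
  shows "M = UNIV"
proof (rule closed_subspace_eq_UNIV[OF M])
  fix v
  assume v: "\<And>y. y \<in> M \<Longrightarrow> Re (cinner v y) = 0"
  have "cinner v (e x) = 0" for x
    using v[OF e[of 1 x]] v[OF e[of \<i> x]] by (simp add: cinner_linear complex_eq_iff)
  then show "v = 0"
    by (rule total)
qed

text \<open>
  The representing vector is a multiple of any nonzero vector \<open>z\<close> orthogonal to the kernel,
  since \<open>v - (f v / f z) z\<close> lies in the kernel for every \<open>v\<close>.
\<close>

lemma Riesz_representation:
  fixes f :: "'v::complex_hilbert_space \<Rightarrow> complex"
  assumes f: "bounded_linear f" and fC: "\<And>c v. f (c *\<^sub>C v) = c * f v"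
  obtains a where "\<And>v. f v = cinner v a"
proof (cases "\<forall>v. f v = 0")
  case True
  then show ?thesis
    using that[of 0] by simp
next
  case False
  interpret f: bounded_linear f by (rule f)
  obtain x where x: "f x \<noteq> 0"
    using False by blast
  define M where "M = {v. f v = 0}"
  have "subspace M"
    unfolding M_def by (auto simp: subspace_def f.zero f.add f.scaleR)
  moreover have "closed M"
    unfolding M_def by (intro closed_Collect_eq linear_continuous_on f continuous_intros)
  ultimately obtain m where m: "m \<in> M" "\<And>y. y \<in> M \<Longrightarrow> Re (cinner (x - m) y) = 0"
    using orthogonal_projection_exists by blast
  define z where "z = x - m"
  have fz: "f z \<noteq> 0"
    using x m(1) by (simp add: z_def f.diff M_def)
  \<comment> \<open>The kernel is a complex subspace, so orthogonality holds for the imaginary part as well.\<close>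
  have perp: "cinner y z = 0" if "y \<in> M" for y
  proof -
    have "\<i> *\<^sub>C y \<in> M"
      using that by (simp add: M_def fC)
    with m(2)[OF that] m(2)[OF this] have "cinner z y = 0"
      by (simp add: z_def cinner_linear complex_eq_iff)
    then show ?thesis
      by (subst cinner_commute) simp
  qed
  have zz: "cinner z z \<noteq> 0"
    using fz f.zero by auto
  have "f v = cinner v (cnj (f z / cinner z z) *\<^sub>C z)" for v
  proof -
    have "v - (f v / f z) *\<^sub>C z \<in> M"
      using fz by (simp add: M_def f.diff fC)
    from perp[OF this] have "cinner v z = f v / f z * cinner z z"
      by (simp add: cinner_linear)
    then show ?thesis
      using fz zz by (simp add: cinner_linear)
  qed
  then show ?thesis by (rule that)
qed

text \<open>
  The vector obtained is the value at \<open>w\<close> of the adjoint of \<open>A\<close>.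
\<close>

lemma bounded_operator_adjoint_vector:
  assumes "bounded_operator A"
  obtains a where "\<And>v. cinner (A v) w = cinner v a"
proof -
  have "bounded_linear (\<lambda>v. cinner (A v) w)"
    using assms unfolding bounded_operator_def
    by (intro bounded_linear_compose[OF bounded_bilinear.bounded_linear_left[OF bounded_bilinear_cinner]]) simp
  moreover have "cinner (A (c *\<^sub>C v)) w = c * cinner (A v) w" for c v
    using assms by (simp add: bounded_operator_def cinner_linear)
  ultimately show ?thesis
    by (rule Riesz_representation) (use that in blast)
qed

lemma bounded_operator_compose:
  "bounded_operator A \<Longrightarrow> bounded_operator B \<Longrightarrow> bounded_operator (A \<circ> B)"
  unfolding bounded_operator_def by (auto intro: bounded_linear_compose simp: o_def)

lemma subspace_closure:
  fixes S :: "'a::real_normed_vector set"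
  assumes "subspace S"
  shows "subspace (closure S)"
proof (rule subspaceI)
  show "0 \<in> closure S"
    using subspace_0[OF assms] closure_subset by blast
  show "x + y \<in> closure S" if xy: "x \<in> closure S" "y \<in> closure S" for x y
  proof -
    obtain a b where "\<And>n. a n \<in> S" "a \<longlonglongrightarrow> x" "\<And>n. b n \<in> S" "b \<longlonglongrightarrow> y"
      using xy unfolding closure_sequential by blast
    then show ?thesis
      unfolding closure_sequential
      by (intro exI[of _ "\<lambda>n. a n + b n"]) (auto intro: tendsto_add subspace_add[OF assms])
  qed
  show "c *\<^sub>R x \<in> closure S" if x: "x \<in> closure S" for c x
  proof -
    obtain a where "\<And>n. a n \<in> S" "a \<longlonglongrightarrow> x"
      using x unfolding closure_sequential by blast
    then show ?thesis
      unfolding closure_sequential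
      by (intro exI[of _ "\<lambda>n. c *\<^sub>R a n"])
        (auto intro: tendsto_scaleR tendsto_const subspace_scale[OF assms])
  qed
qed

text \<open>
  If the Gram matrices of two families agree up to conjugation and the first family is total, then
  \<open>\<Sum> c\<^sub>x e\<^sub>x \<mapsto> \<Sum> cnj c\<^sub>x e'\<^sub>x\<close> is a well-defined
  antilinear isometry on the span of the first family and extends by continuity to the whole space. The
  proof works with the closure of the graph, which avoids choosing representations of vectors as linear
  combinations.
\<close>

lemma antiunitary_extension:
  fixes e e' :: "'p \<Rightarrow> 'v::complex_hilbert_space"
  assumes total: "\<And>v. (\<And>x. cinner v (e x) = 0) \<Longrightarrow> v = 0"
    and kernel: "\<And>x y. cinner (e y) (e x) = cinner (e' x) (e' y)"
  obtains J where "\<And>u v. cinner u v = cinner (J v) (J u)" "\<And>x. J (e x) = e' x"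
proof -
  define S where "S = span (range (\<lambda>(c, x). (c *\<^sub>C e x, cnj c *\<^sub>C e' x)))"
  have form0: "cinner (fst p) (fst q) = cinner (snd q) (snd p)" if "p \<in> S" "q \<in> S" for p q
    using that(1) unfolding S_def
  proof (induction p rule: span_induct_alt)
    case (step r p0 p)
    obtain c x where p0: "p0 = (c *\<^sub>C e x, cnj c *\<^sub>C e' x)"
      using step(1) by auto
    have "cinner (fst p0) (fst q) = cinner (snd q) (snd p0)"
      using that(2) unfolding S_def
    proof (induction q rule: span_induct_alt)
      case (step r' q0 q)
      obtain d y where "q0 = (d *\<^sub>C e y, cnj d *\<^sub>C e' y)"
        using step(1) by auto
      then show ?case
        using step(2) kernel[of x y] by (simp add: p0 cinner_linear algebra_simps)
    qed simp
    then show ?case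
      using step(2) by (simp add: cinner_linear)
  qed simp
  have iso0: "norm (snd p) = norm (fst p)" if "p \<in> S" for p
    using form0[OF that that] by (simp add: cinner_self power2_eq_iff_nonneg del: of_real_power)
  have form: "cinner (fst p) (fst q) = cinner (snd q) (snd p)" if "p \<in> closure S" "q \<in> closure S" for p q
  proof -
    have "(p, q) \<in> closure (S \<times> S)"
      using that by (simp add: closure_Times)
    also have "closure (S \<times> S) \<subseteq> {(p, q). cinner (fst p) (fst q) = cinner (snd q) (snd p)}"
      using form0 unfolding case_prod_beta
      by (intro closure_minimal closed_Collect_eq continuous_intros) auto
    finally show ?thesis by simp
  qed
  have sub: "subspace (fst ` S)"
    unfolding S_def by (intro linear_subspace_image bounded_linear.linear bounded_linear_fst subspace_span)
  have "closure (fst ` S) = UNIV"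
  proof (rule closed_subspace_eq_UNIV_of_total[OF _ _ _ total])
    show "subspace (closure (fst ` S))"
      using sub by (rule subspace_closure)
    have "(c *\<^sub>C e x, cnj c *\<^sub>C e' x) \<in> S" for c x
      unfolding S_def by (rule span_base) auto
    then show "c *\<^sub>C e x \<in> closure (fst ` S)" for c x
      by (force intro!: subsetD[OF closure_subset] image_eqI)
  qed auto
  have "\<exists>v'. (v, v') \<in> closure S" for v
  proof -
    obtain s where s: "\<And>n. s n \<in> fst ` S" "s \<longlonglongrightarrow> v"
      using \<open>closure (fst ` S) = UNIV\<close> closure_sequential[of v] by blast
    have "\<exists>v'. (s n, v') \<in> S" for n
      using s(1)[of n] by auto
    then obtain s' where s': "\<And>n. (s n, s' n) \<in> S"
      by metis
    have isometric: "dist (s' i) (s' j) = dist (s i) (s j)" for i j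
    proof -
      have "(s i, s' i) - (s j, s' j) \<in> S"
        using s' unfolding S_def by (intro span_diff)
      from iso0[OF this] show ?thesis
        by (simp add: dist_norm)
    qed
    have "Cauchy s'"
      using LIMSEQ_imp_Cauchy[OF s(2)] by (simp add: Cauchy_def isometric)
    then obtain v' where "s' \<longlonglongrightarrow> v'"
      using Cauchy_convergent convergent_def by blast
    then have "(\<lambda>n. (s n, s' n)) \<longlonglongrightarrow> (v, v')"
      by (intro tendsto_Pair s)
    then show ?thesis
      unfolding closure_sequential using s' by (intro exI[of _ v'] exI[of _ "\<lambda>n. (s n, s' n)"]) simp
  qed
  then obtain J where J: "\<And>v. (v, J v) \<in> closure S"
    by metis
  have "J (e x) = e' x" for x
  proof -
    have "(1 *\<^sub>C e x, cnj 1 *\<^sub>C e' x) \<in> S"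
      unfolding S_def by (rule span_base) (rule rev_image_eqI[of "(1, x)"], auto)
    then have "(e x, e' x) \<in> closure S"
      using closure_subset[of S] by (simp add: scaleC_one subset_iff)
    then have "(e x, J (e x)) - (e x, e' x) \<in> closure S"
      using J by (intro subspace_diff subspace_closure) (simp_all add: S_def)
    then show ?thesis
      using form[of "(0, J (e x) - e' x)" "(0, J (e x) - e' x)"] by simp
  qed
  moreover have "cinner u v = cinner (J v) (J u)" for u v
    using form[OF J J] by simp
  ultimately show ?thesis
    using that by blast
qed

text \<open>
  Let \<open>J\<close> be the antiunitary map with \<open>J e\<^sub>x = e'\<^sub>x\<close>. Symmetry of the
  kernel of an operator \<open>C\<close> says that \<open>J C J\<inverse>\<close> is the adjoint of
  \<open>C\<close>. Conjugation by \<open>J\<close> preserves the order of products while taking adjoints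
  reverses it, so symmetry for \<open>A\<close>, \<open>B\<close> and \<open>B A\<close> forces
  \<open>A\<close> and \<open>B\<close> to commute. The operator \<open>A\<close> enters the computation
  through the vectors \<open>a\<close> that represent \<open>v \<mapsto> cinner (A v) (e x)\<close>.
\<close>

lemma bounded_operators_commute_if_kernels_symmetric:
  fixes e e' :: "'p \<Rightarrow> 'v::complex_hilbert_space"
  assumes total: "\<And>v. (\<And>x. cinner v (e x) = 0) \<Longrightarrow> v = 0"
    and total': "\<And>v. (\<And>x. cinner v (e' x) = 0) \<Longrightarrow> v = 0"
    and A: "bounded_operator A" and B: "bounded_operator B"
    and sym: "\<And>x y. cinner (e y) (e x) = cinner (e' x) (e' y)"
    and symA: "\<And>x y. cinner (A (e y)) (e x) = cinner (A (e' x)) (e' y)"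
    and symB: "\<And>x y. cinner (B (e y)) (e x) = cinner (B (e' x)) (e' y)"
    and symBA: "\<And>x y. cinner (B (A (e y))) (e x) = cinner (B (A (e' x))) (e' y)"
  shows "A \<circ> B = B \<circ> A"
proof -
  obtain J where J: "\<And>u v. cinner u v = cinner (J v) (J u)" "\<And>x. J (e x) = e' x"
    using antiunitary_extension[of e e', OF total sym] by blast
  have eqI: "u = v" if "\<And>x. cinner (e' x) u = cinner (e' x) v" for u v
    using total'[of "u - v"] that by (metis cinner_commute cinner_diff_left right_minus_eq)
  have adjoint: "cinner v (J (C (e y))) = cinner (C v) (e' y)"
    if C: "bounded_operator C" and symC: "\<And>x y. cinner (C (e y)) (e x) = cinner (C (e' x)) (e' y)"
    for C v y
  proof -
    obtain a where a: "\<And>v. cinner (C v) (e' y) = cinner v a"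
      using bounded_operator_adjoint_vector[OF C] by blast
    have "J (C (e y)) = a"
      by (rule eqI) (metis J a symC)
    then show ?thesis
      using a by simp
  qed
  have "cinner (A (B (e y))) (e x) = cinner (B (A (e y))) (e x)" for x y
  proof -
    obtain a where a: "\<And>v. cinner (A v) (e x) = cinner v a"
      using bounded_operator_adjoint_vector[OF A] by blast
    have Ja: "J a = A (e' x)"
    proof (rule eqI)
      fix z
      have "cinner (J a) (e' z) = cinner (A (e z)) (e x)"
        by (metis J a)
      also have "\<dots> = cinner (A (e' x)) (e' z)"
        by (rule symA)
      finally show "cinner (e' z) (J a) = cinner (e' z) (A (e' x))"
        by (metis cinner_commute)
    qed
    have "cinner (A (B (e y))) (e x) = cinner (J a) (J (B (e y)))"
      using a J(1) by simp
    also have "\<dots> = cinner (B (A (e' x))) (e' y)"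
      using Ja adjoint[OF B symB] by simp
    finally show ?thesis
      using symBA by simp
  qed
  then have AB: "A (B (e y)) = B (A (e y))" for y
    using total[of "A (B (e y)) - B (A (e y))"] by (simp add: cinner_diff_left)
  have bl: "bounded_linear A" "bounded_linear B"
    and AC: "\<And>c v. A (c *\<^sub>C v) = c *\<^sub>C A v" and BC: "\<And>c v. B (c *\<^sub>C v) = c *\<^sub>C B v"
    using A B by (auto simp: bounded_operator_def)
  interpret A: bounded_linear A by (rule bl)
  interpret B: bounded_linear B by (rule bl)
  have "{v. A (B v) = B (A v)} = UNIV"
  proof (rule closed_subspace_eq_UNIV_of_total[where e = e, OF _ _ _ total])
    show "subspace {v. A (B v) = B (A v)}"
      by (auto simp: subspace_def A.zero B.zero A.add B.add A.scaleR B.scaleR)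
    show "closed {v. A (B v) = B (A v)}"
      by (intro closed_Collect_eq A.continuous_on B.continuous_on continuous_intros)
  qed (simp_all add: AB AC BC)
  then show ?thesis
    by (auto simp: fun_eq_iff)
qed

section \<open>Polarization of holomorphic kernels\<close>

text \<open>
  Cauchy's estimate on discs of radius \<open>R\<close> bounds the derivative.
\<close>

lemma entire_Lipschitz:
  fixes f :: "complex \<Rightarrow> complex"
  assumes f: "f holomorphic_on UNIV" and R: "R > 0"
    and M: "\<And>z. cmod z \<le> 2 * R \<Longrightarrow> cmod (f z) \<le> M"
    and x: "cmod x \<le> R" and y: "cmod y \<le> R"
  shows "cmod (f x - f y) \<le> M / R * cmod (x - y)"
proof (rule field_differentiable_bound[of "cball 0 R" f "deriv f"])
  show "(f has_field_derivative deriv f z) (at z within cball 0 R)" for z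
    using holomorphic_derivI[OF f, of z] by (simp add: has_field_derivative_at_within)
  show "cmod (deriv f z) \<le> M / R" if z: "z \<in> cball 0 R" for z
  proof -
    have "cmod ((deriv ^^ 1) f z) \<le> fact 1 * M / R ^ 1"
    proof (rule Cauchy_inequality)
      show "f holomorphic_on ball z R"
        using f by (rule holomorphic_on_subset) simp
      show "continuous_on (cball z R) f"
        by (intro holomorphic_on_imp_continuous_on holomorphic_on_subset[OF f]) auto
      show "cmod (f w) \<le> M" if "cmod (z - w) = R" for w
        using that z norm_triangle_ineq2[of w z] by (intro M) (simp add: norm_minus_commute)
    qed (rule R)
    then show ?thesis by simp
  qed
qed (use x y in auto)

text \<open>
  The Lipschitz estimate is applied in each variable in turn. That the mixed difference is of second order
  is what makes a separately entire, locally bounded function differentiable along curves.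
\<close>

lemma mixed_difference_bound:
  fixes h :: "complex \<Rightarrow> complex \<Rightarrow> complex"
  assumes h1: "\<And>t. (\<lambda>s. h s t) holomorphic_on UNIV" and h2: "\<And>s. h s holomorphic_on UNIV"
    and R: "R > 0" and M: "\<And>s t. cmod s \<le> 2 * R \<Longrightarrow> cmod t \<le> 2 * R \<Longrightarrow> cmod (h s t) \<le> M"
    and "cmod s \<le> R" "cmod s' \<le> R" "cmod t \<le> R" "cmod t' \<le> R"
  shows "cmod ((h s' t' - h s t') - (h s' t - h s t)) \<le> M / R / R * cmod (s' - s) * cmod (t' - t)"
proof -
  have "cmod (h s' \<tau> - h s \<tau>) \<le> M / R * cmod (s' - s)" if "cmod \<tau> \<le> 2 * R" for \<tau>
    using that assms by (intro entire_Lipschitz[OF h1 R M]) auto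
  then have "cmod ((h s' t' - h s t') - (h s' t - h s t)) \<le> (M / R * cmod (s' - s)) / R * cmod (t' - t)"
    using assms by (intro entire_Lipschitz[of "\<lambda>t. h s' t - h s t"] holomorphic_intros) auto
  then show ?thesis
    by (simp add: field_simps)
qed

text \<open>
  A form of Osgood's lemma: \<open>h (a z) (b z)\<close> is the sum of two functions in each of which only
  one argument of \<open>h\<close> moves, a constant, and a mixed difference \<open>m\<close> whose
  derivative at \<open>w\<close> vanishes.
\<close>

lemma separately_entire_compose_holomorphic:
  fixes h :: "complex \<Rightarrow> complex \<Rightarrow> complex"
  assumes h1: "\<And>t. (\<lambda>s. h s t) holomorphic_on UNIV" and h2: "\<And>s. h s holomorphic_on UNIV"
    and bdd: "\<And>R. \<exists>M. \<forall>s t. cmod s \<le> R \<longrightarrow> cmod t \<le> R \<longrightarrow> cmod (h s t) \<le> M"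
    and a: "a holomorphic_on S" and b: "b holomorphic_on S" and S: "open S"
  shows "(\<lambda>z. h (a z) (b z)) holomorphic_on S"
proof -
  have "(\<lambda>z. h (a z) (b z)) field_differentiable at w" if w: "w \<in> S" for w
  proof -
    define m where "m z = (h (a z) (b z) - h (a w) (b z)) - (h (a z) (b w) - h (a w) (b w))" for z
    define R where "R = cmod (a w) + cmod (b w) + 1"
    have R: "R > 0"
      by (simp add: R_def add_nonneg_pos)
    obtain M where M: "\<And>s t. cmod s \<le> 2 * R \<Longrightarrow> cmod t \<le> 2 * R \<Longrightarrow> cmod (h s t) \<le> M"
      using bdd[of "2 * R"] by blast
    have da: "(a has_field_derivative deriv a w) (at w)" and db: "(b has_field_derivative deriv b w) (at w)"
      using a b S w holomorphic_derivI by blast+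
    have lima: "a \<midarrow>w\<rightarrow> a w" and limb: "b \<midarrow>w\<rightarrow> b w"
      using da db DERIV_isCont isContD by blast+
    have aR: "cmod (a w) < R" and bR: "cmod (b w) < R"
      using norm_ge_zero[of "a w"] norm_ge_zero[of "b w"] unfolding R_def by linarith+
    have "\<forall>\<^sub>F z in at w. cmod (a z) < R" "\<forall>\<^sub>F z in at w. cmod (b z) < R"
      by (rule order_tendstoD(2)[OF tendsto_norm[OF lima] aR]
        order_tendstoD(2)[OF tendsto_norm[OF limb] bR])+
    then have "\<forall>\<^sub>F z in at w. norm ((m z - m w) / (z - w)) \<le>
        M / R / R * cmod ((a z - a w) / (z - w)) * cmod (b z - b w)"
    proof eventually_elim
      case (elim z)
      have "cmod (m z) \<le> M / R / R * cmod (a z - a w) * cmod (b z - b w)"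
        unfolding m_def using elim aR bR
        by (intro mixed_difference_bound[OF h1 h2 R M]) auto
      then have "cmod (m z) / cmod (z - w) \<le>
          M / R / R * cmod (a z - a w) * cmod (b z - b w) / cmod (z - w)"
        by (intro divide_right_mono) auto
      then show ?case
        by (simp add: m_def norm_divide field_simps)
    qed
    moreover have "((\<lambda>z. M / R / R * cmod ((a z - a w) / (z - w)) * cmod (b z - b w)) \<longlongrightarrow> 0) (at w)"
    proof -
      have "((\<lambda>z. M / R / R * cmod ((a z - a w) / (z - w)) * cmod (b z - b w)) \<longlongrightarrow>
          M / R / R * cmod (deriv a w) * cmod (b w - b w)) (at w)"
        using da limb unfolding has_field_derivative_iff by (intro tendsto_intros)
      then show ?thesis
        by simp
    qed
    ultimately have "(\<lambda>z. (m z - m w) / (z - w)) \<midarrow>w\<rightarrow> 0"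
      by (rule Lim_null_comparison)
    then have "(m has_field_derivative 0) (at w)"
      by (simp add: has_field_derivative_iff)
    then have "m field_differentiable at w"
      by (auto simp: field_differentiable_def)
    moreover have "(\<lambda>z. h (a w) (b z)) field_differentiable at w"
      using field_differentiable_compose[of b w "h (a w)"] db h2
      by (auto simp: o_def field_differentiable_def holomorphic_on_def)
    moreover have "(\<lambda>z. h (a z) (b w)) field_differentiable at w"
      using field_differentiable_compose[of a w "\<lambda>s. h s (b w)"] da h1
      by (auto simp: o_def field_differentiable_def holomorphic_on_def)
    ultimately have "(\<lambda>z. m z + h (a w) (b z) + h (a z) (b w) - h (a w) (b w)) field_differentiable at w"
      by (intro derivative_intros field_differentiable_add field_differentiable_diff field_differentiable_const)
    then show ?thesis
      by (simp add: m_def)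
  qed
  then show ?thesis
    by (simp add: holomorphic_on_def field_differentiable_at_within)
qed

text \<open>
  On the circle of radius \<open>\<rho>\<close> one has \<open>cnj z = \<rho>\<^sup>2 / z\<close>, so the
  holomorphic function \<open>z \<mapsto> h z (\<rho>\<^sup>2 / z)\<close> vanishes on this circle and hence
  for all \<open>z \<noteq> 0\<close>. Letting \<open>\<rho>\<close> vary, one finds for each fixed \<open>z
  \<noteq> 0\<close> a whole segment of zeros of \<open>h z\<close>.
\<close>

lemma separately_entire_eq_0_if_antidiagonal_eq_0:
  fixes h :: "complex \<Rightarrow> complex \<Rightarrow> complex"
  assumes h1: "\<And>t. (\<lambda>s. h s t) holomorphic_on UNIV" and h2: "\<And>s. h s holomorphic_on UNIV"
    and bdd: "\<And>R. \<exists>M. \<forall>s t. cmod s \<le> R \<longrightarrow> cmod t \<le> R \<longrightarrow> cmod (h s t) \<le> M"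
    and r: "r > 0" and zero: "\<And>t. cmod t < r \<Longrightarrow> h t (cnj t) = 0"
  shows "h s t = 0"
proof -
  have hyperbola: "h z (complex_of_real (\<rho>\<^sup>2) / z) = 0" if \<rho>: "0 < \<rho>" "\<rho> < r" and z: "z \<noteq> 0" for \<rho> z
  proof (rule analytic_continuation[of "\<lambda>z. h z (complex_of_real (\<rho>\<^sup>2) / z)" "- {0}" "sphere 0 \<rho>" "complex_of_real \<rho>"])
    show "(\<lambda>z. h z (complex_of_real (\<rho>\<^sup>2) / z)) holomorphic_on - {0}"
      by (intro separately_entire_compose_holomorphic[OF h1 h2 bdd] holomorphic_intros) auto
    show "connected (- {0 :: complex})"
      by (intro connected_punctured_universe) simp
    show "complex_of_real \<rho> islimpt sphere 0 \<rho>"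
    proof (rule connected_imp_perfect)
      show "connected (sphere (0 :: complex) \<rho>)"
        by (intro connected_sphere) simp
      have "complex_of_real \<rho> \<in> sphere 0 \<rho>" "- complex_of_real \<rho> \<in> sphere 0 \<rho>" 
          "complex_of_real \<rho> \<noteq> - complex_of_real \<rho>"
        using \<rho> by auto
      then show "sphere (0 :: complex) \<rho> \<noteq> {a}" for a
        by (metis singletonD)
      show "complex_of_real \<rho> \<in> sphere 0 \<rho>"
        using \<rho> by simp
    qed
    show "h w (complex_of_real (\<rho>\<^sup>2) / w) = 0" if "w \<in> sphere 0 \<rho>" for w
    proof -
      have w: "cmod w = \<rho>" "w \<noteq> 0"
        using that \<rho> by auto
      have "w * cnj w = complex_of_real (\<rho>\<^sup>2)"
        using w(1) by (simp add: complex_norm_square[symmetric] del: of_real_power)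
      then have "complex_of_real (\<rho>\<^sup>2) / w = cnj w"
        using w(2) by (simp add: field_simps)
      then show ?thesis
        using zero[of w] w \<rho> by simp
    qed
  qed (use \<rho> z in auto)
  have line: "h z w = 0" if z: "z \<noteq> 0" for z w
  proof -
    have "h z ((z * w) / z) = 0"
    proof (rule analytic_continuation[of "\<lambda>u. h z (u / z)" UNIV "complex_of_real ` {0<..<r\<^sup>2}" "complex_of_real (r\<^sup>2 / 2)"])
      show "(\<lambda>u. h z (u / z)) holomorphic_on UNIV"
        using holomorphic_on_compose_gen[OF _ h2, of "\<lambda>u. u / z" UNIV z] z
        by (simp add: o_def holomorphic_intros)
      show "complex_of_real (r\<^sup>2 / 2) islimpt complex_of_real ` {0<..<r\<^sup>2}"
      proof (rule connected_imp_perfect)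
        show "connected (complex_of_real ` {0<..<r\<^sup>2})"
          by (intro connected_continuous_image continuous_intros) simp
        have "r\<^sup>2 / 2 \<in> {0<..<r\<^sup>2}" "r\<^sup>2 / 3 \<in> {0<..<r\<^sup>2}" "r\<^sup>2 / 2 \<noteq> r\<^sup>2 / 3"
          using r by (auto simp: field_simps)
        then show "complex_of_real ` {0<..<r\<^sup>2} \<noteq> {a}" for a
          by (metis image_eqI of_real_eq_iff singletonD)
        show "complex_of_real (r\<^sup>2 / 2) \<in> complex_of_real ` {0<..<r\<^sup>2}"
          by (rule imageI) fact
      qed
      show "h z (u / z) = 0" if u: "u \<in> complex_of_real ` {0<..<r\<^sup>2}" for u
      proof -
        obtain q where q: "u = complex_of_real q" "0 < q" "q < r\<^sup>2"
          using u by auto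
        then have "0 < sqrt q" "sqrt q < r"
          using r by (auto simp: real_less_lsqrt)
        from hyperbola[OF this z] show ?thesis
          using q by simp
      qed
    qed auto
    then show ?thesis
      using z by simp
  qed
  show ?thesis
  proof (rule analytic_continuation[of "\<lambda>s. h s t" UNIV "- {0}" 1])
    show "(1 :: complex) islimpt - {0}"
      by (intro interior_limit_point, subst interior_open) auto
  qed (use h1 line in auto)
qed

lemma cholomorphic_on_line:
  assumes "cholomorphic_on f UNIV"
  shows "(\<lambda>s. f (x + s *s u)) holomorphic_on UNIV"
  unfolding holomorphic_on_def
proof
  fix s :: complex
  obtain f' where f': "(f has_derivative f') (at (x + s *s u))" "\<And>c v. f' (c *s v) = c * f' v"
    using assms unfolding cholomorphic_on_def by blast
  have lin: "bounded_linear (\<lambda>s :: complex. s *s u)"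
    by (intro linear_conv_bounded_linear[THEN iffD1] linearI)
      (simp_all add: vec_eq_iff algebra_simps)
  have "((\<lambda>s. x + s *s u) has_derivative (\<lambda>s. s *s u)) (at s)"
    by (intro has_derivative_eq_rhs[OF has_derivative_add[OF has_derivative_const
      bounded_linear.has_derivative[OF lin has_derivative_ident]]]) simp
  from has_derivative_compose[OF this f'(1)]
  have "((\<lambda>s. f (x + s *s u)) has_derivative (\<lambda>s. s * f' u)) (at s)"
    by (simp add: f'(2))
  then have "((\<lambda>s. f (x + s *s u)) has_field_derivative f' u) (at s)"
    by (simp add: has_field_derivative_def mult.commute[of _ "f' u"])
  then show "(\<lambda>s. f (x + s *s u)) field_differentiable at s within UNIV"
    by (auto simp: field_differentiable_def)
qed

text \<open>
  The identity theorem on the complex line through \<open>x\<close> and \<open>y\<close>.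
\<close>

lemma cholomorphic_eq_0:
  assumes f: "cholomorphic_on f UNIV" and W: "open W" "x \<in> W" and zero: "\<And>x. x \<in> W \<Longrightarrow> f x = 0"
  shows "f y = 0"
proof -
  define V where "V = (\<lambda>s :: complex. x + s *s (y - x)) -` W"
  have lin: "bounded_linear (\<lambda>s :: complex. s *s (y - x))"
    by (intro linear_conv_bounded_linear[THEN iffD1] linearI)
      (simp_all add: vec_eq_iff algebra_simps)
  have "open V"
    unfolding V_def by (intro open_vimage W continuous_intros linear_continuous_on lin)
  moreover have "0 \<in> V"
    using W(2) by (simp add: V_def)
  ultimately have "(0 :: complex) islimpt V"
    by (intro interior_limit_point) (simp add: interior_open)
  have "f (x + 1 *s (y - x)) = 0"
    by (rule analytic_continuation[OF cholomorphic_on_line[OF f] open_UNIV connected_UNIV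
      subset_UNIV UNIV_I \<open>0 islimpt V\<close>]) (auto simp: V_def zero)
  then show ?thesis by simp
qed

lemma norm_complex_scale_le: "norm (s *s u) \<le> cmod s * norm (u :: complex ^ 'm)"
proof -
  have "norm (s *s u) = L2_set (\<lambda>i. cmod s * cmod (u $ i)) UNIV"
    by (simp add: norm_vec_def norm_mult)
  also have "\<dots> = cmod s * norm u"
    by (simp add: norm_vec_def L2_set_left_distrib[symmetric] L2_set_right_distrib)
  finally show ?thesis by simp
qed

text \<open>
  Any two points lie on a complex line, and if the first one is in \<open>W\<close>, the restriction of the
  kernel to this line vanishes on the diagonal near that point. So the one-variable case gives \<open>F x y
  = 0\<close> for \<open>x \<in> W\<close> and all \<open>y\<close>, and the identity theorem in
  \<open>x\<close> does the rest.
\<close>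

theorem sesquiholomorphic_kernel_eq_0:
  fixes F :: "complex ^ 'm \<Rightarrow> complex ^ 'm \<Rightarrow> complex"
  assumes F1: "\<And>y. cholomorphic_on (\<lambda>x. F x y) UNIV"
    and F2: "\<And>x. cholomorphic_on (\<lambda>y. cnj (F x y)) UNIV"
    and bdd: "\<And>R. \<exists>M. \<forall>x y. norm x \<le> R \<longrightarrow> norm y \<le> R \<longrightarrow> cmod (F x y) \<le> M"
    and W: "open W" "W \<noteq> {}" and zero: "\<And>x. x \<in> W \<Longrightarrow> F x x = 0"
  shows "F x y = 0"
proof -
  have W0: "F x y = 0" if x: "x \<in> W" for x y
  proof -
    define u where "u = y - x"
    \<comment> \<open>Conjugating \<open>t\<close> makes the kernel holomorphic in both variables and turns the diagonal into \<open>(t, cnj t)\<close>.\<close>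
    define h where "h s t = F (x + s *s u) (x + cnj t *s u)" for s t
    obtain e where e: "e > 0" "ball x e \<subseteq> W"
      using W(1) x openE by blast
    have "h 0 1 = 0"
    proof (rule separately_entire_eq_0_if_antidiagonal_eq_0[of h "e / (norm u + 1)"])
      show "(\<lambda>s. h s t) holomorphic_on UNIV" for t
        unfolding h_def by (rule cholomorphic_on_line[OF F1])
      show "h s holomorphic_on UNIV" for s
      proof -
        have "cnj \<circ> (\<lambda>t. cnj (F (x + s *s u) (x + t *s u))) \<circ> cnj holomorphic_on UNIV"
          by (rule holomorphic_on_compose_cnj_cnj)
            (auto intro: holomorphic_on_subset[OF cholomorphic_on_line[OF F2]])
        also have "cnj \<circ> (\<lambda>t. cnj (F (x + s *s u) (x + t *s u))) \<circ> cnj = h s"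
          by (simp add: fun_eq_iff h_def)
        finally show ?thesis .
      qed
      show "\<exists>M. \<forall>s t. cmod s \<le> R \<longrightarrow> cmod t \<le> R \<longrightarrow> cmod (h s t) \<le> M" for R
      proof -
        obtain M where M: "\<And>a b. norm a \<le> norm x + R * norm u \<Longrightarrow> norm b \<le> norm x + R * norm u \<Longrightarrow>
            cmod (F a b) \<le> M"
          using bdd by metis
        have "norm (x + s *s u) \<le> norm x + R * norm u" if "cmod s \<le> R" for s
          using norm_triangle_ineq[of x "s *s u"] norm_complex_scale_le[of s u]
            mult_right_mono[OF that norm_ge_zero[of u]] by linarith
        then show ?thesis
          unfolding h_def by (intro exI[of _ M] allI impI M) simp_all
      qed
      show "e / (norm u + 1) > 0"
        using e by (simp add: add_nonneg_pos)
      show "h t (cnj t) = 0" if "cmod t < e / (norm u + 1)" for t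
      proof -
        have "norm (t *s u) \<le> cmod t * (norm u + 1)"
          using norm_complex_scale_le[of t u] norm_ge_zero[of t] unfolding distrib_left by linarith
        also have "\<dots> < e"
          using that by (simp add: pos_less_divide_eq add_nonneg_pos)
        finally have "x + t *s u \<in> W"
          using e(2) by (auto simp: dist_norm)
        then show ?thesis
          by (simp add: h_def zero)
      qed
    qed
    then show ?thesis
      by (simp add: h_def u_def)
  qed
  obtain x0 where "x0 \<in> W"
    using W(2) by blast
  then show ?thesis
    by (rule cholomorphic_eq_0[OF F1 W(1)]) (rule W0)
qed

section \<open>Multiplicity-freeness from an orbit-preserving anti-holomorphic symmetry\<close>

text \<open>
  Point evaluations of a Hilbert space of functions that embeds continuously into the functions on
  \<open>\<complex>\<^sup>m\<close>: the third conjunct is continuity for uniform convergence on bounded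
  sets, the fourth is injectivity.
\<close>

definition evaluation_family :: "('v::complex_hilbert_space \<Rightarrow> complex ^ 'm::finite \<Rightarrow> complex) \<Rightarrow> bool" where
  "evaluation_family ev \<longleftrightarrow>
     (\<forall>u v x. ev (u + v) x = ev u x + ev v x) \<and>
     (\<forall>c v x. ev (c *\<^sub>C v) x = c * ev v x) \<and>
     (\<forall>R. \<exists>C. \<forall>x v. norm x \<le> R \<longrightarrow> cmod (ev v x) \<le> C * norm v) \<and>
     (\<forall>v. (\<forall>x. ev v x = 0) \<longrightarrow> v = 0)"

text \<open>
  The vectors \<open>e x\<close> represent the point evaluations, so \<open>cinner (e y) (e x)\<close> is
  the reproducing kernel.
\<close>

lemma evaluation_vectors:
  assumes "evaluation_family ev"
  obtains e where "\<And>v x. ev v x = cinner v (e x)"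
    and "\<And>R. \<exists>C. \<forall>x. norm x \<le> R \<longrightarrow> norm (e x) \<le> C"
    and "\<And>v. (\<And>x. cinner v (e x) = 0) \<Longrightarrow> v = 0"
proof -
  have add: "ev (u + v) x = ev u x + ev v x" and scale: "ev (c *\<^sub>C v) x = c * ev v x" for u v c x
    using assms by (auto simp: evaluation_family_def)
  have bound: "\<exists>C. \<forall>x v. norm x \<le> R \<longrightarrow> cmod (ev v x) \<le> C * norm v" for R
    using assms by (auto simp: evaluation_family_def)
  have "\<exists>a. \<forall>v. ev v x = cinner v a" for x
  proof -
    obtain C where "\<And>v. cmod (ev v x) \<le> norm v * C"
      using bound[of "norm x"] by (metis order_refl mult.commute)
    then have "bounded_linear (\<lambda>v. ev v x)"
      by (rule bounded_linear_intro[rotated 2]) (simp_all add: add scaleR_scaleC scale scaleR_conv_of_real)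
    then obtain a where "\<And>v. ev v x = cinner v a"
      using Riesz_representation[of "\<lambda>v. ev v x"] scale by blast
    then show ?thesis by blast
  qed
  then obtain e where e: "\<And>v x. ev v x = cinner v (e x)"
    by metis
  have "\<exists>C. \<forall>x. norm x \<le> R \<longrightarrow> norm (e x) \<le> C" for R
  proof -
    obtain C where C: "\<And>x v. norm x \<le> R \<Longrightarrow> cmod (ev v x) \<le> C * norm v"
      using bound by metis
    have "norm (e x) \<le> max C 0" if "norm x \<le> R" for x
    proof (cases "e x = 0")
      case False
      have "norm (e x) * norm (e x) = cmod (ev (e x) x)"
        by (simp add: e cinner_self norm_power power2_eq_square norm_mult)
      also have "\<dots> \<le> C * norm (e x)"
        using C that by blast
      finally have "norm (e x) \<le> C"
        using False by (simp add: mult_le_cancel_right)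
      then show ?thesis
        by simp
    qed simp
    then show ?thesis by blast
  qed
  moreover have "v = 0" if "\<And>x. cinner v (e x) = 0" for v
    using assms that by (auto simp: evaluation_family_def e)
  ultimately show ?thesis
    using that e by blast
qed

lemma cholomorphic_on_diff:
  assumes "cholomorphic_on f A" "cholomorphic_on g A"
  shows "cholomorphic_on (\<lambda>x. f x - g x) A"
  unfolding cholomorphic_on_def
proof
  fix x assume x: "x \<in> A"
  obtain f' g' where "(f has_derivative f') (at x)" "\<forall>c v. f' (c *s v) = c * f' v"
      "(g has_derivative g') (at x)" "\<forall>c v. g' (c *s v) = c * g' v"
    using assms x unfolding cholomorphic_on_def by meson
  then show "\<exists>h'. ((\<lambda>x. f x - g x) has_derivative h') (at x) \<and> (\<forall>c v. h' (c *s v) = c * h' v)"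
    by (intro exI[of _ "\<lambda>v. f' v - g' v"]) (auto intro: has_derivative_diff simp: algebra_simps)
qed

text \<open>
  Both sides are holomorphic in \<open>x\<close> and anti-holomorphic in \<open>y\<close>, so it suffices to
  compare them on the diagonal over an open set. On the right the arguments are exchanged because
  \<open>e'\<close> depends on its argument in the opposite way to \<open>e\<close>.
\<close>

lemma kernel_symmetric_if_diagonal_invariant:
  fixes e e' :: "complex ^ 'm::finite \<Rightarrow> 'v::complex_hilbert_space"
  assumes hol: "\<And>v. cholomorphic_on (\<lambda>x. cinner v (e x)) UNIV"
    and antihol: "\<And>v. cholomorphic_on (\<lambda>x. cnj (cinner v (e' x))) UNIV"
    and bound: "\<And>R. \<exists>C. \<forall>x. norm x \<le> R \<longrightarrow> norm (e x) \<le> C"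
    and bound': "\<And>R. \<exists>C. \<forall>x. norm x \<le> R \<longrightarrow> norm (e' x) \<le> C"
    and W: "open W" "W \<noteq> {}" and X: "bounded_operator X"
    and diag: "\<And>x. x \<in> W \<Longrightarrow> cinner (X (e' x)) (e' x) = cinner (X (e x)) (e x)"
  shows "cinner (X (e y)) (e x) = cinner (X (e' x)) (e' y)"
proof -
  define F where "F x y = cinner (X (e y)) (e x) - cinner (X (e' x)) (e' y)" for x y
  have "F x y = 0"
  proof (rule sesquiholomorphic_kernel_eq_0[of F W])
    show "cholomorphic_on (\<lambda>x. F x y) UNIV" for y
    proof -
      obtain a where "\<And>v. cinner (X v) (e' y) = cinner v a"
        using bounded_operator_adjoint_vector[OF X] by blast
      then have "F x y = cinner (X (e y)) (e x) - cnj (cinner a (e' x))" for x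
        by (metis F_def cinner_commute)
      then show ?thesis
        by (simp add: cholomorphic_on_diff hol antihol)
    qed
    show "cholomorphic_on (\<lambda>y. cnj (F x y)) UNIV" for x
    proof -
      obtain a where "\<And>v. cinner (X v) (e x) = cinner v a"
        using bounded_operator_adjoint_vector[OF X] by blast
      then have "cnj (F x y) = cinner a (e y) - cnj (cinner (X (e' x)) (e' y))" for y
        by (metis F_def cinner_commute complex_cnj_diff)
      then show ?thesis
        by (simp add: cholomorphic_on_diff hol antihol)
    qed
    show "\<exists>M. \<forall>x y. norm x \<le> R \<longrightarrow> norm y \<le> R \<longrightarrow> cmod (F x y) \<le> M" for R
    proof -
      obtain B where B: "B > 0" "\<And>v. norm (X v) \<le> norm v * B"
        using X bounded_linear.pos_bounded unfolding bounded_operator_def by metis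
      obtain C where C: "\<And>x. norm x \<le> R \<Longrightarrow> norm (e x) \<le> C"
        using bound by metis
      obtain C' where C': "\<And>x. norm x \<le> R \<Longrightarrow> norm (e' x) \<le> C'"
        using bound' by metis
      have kernel_bound: "cmod (cinner (X u) v) \<le> (D * B) * D" if "norm u \<le> D" "norm v \<le> D" for u v D
      proof -
        have D: "D \<ge> 0"
          using that(1) norm_ge_zero order_trans by blast
        have "cmod (cinner (X u) v) \<le> norm (X u) * norm v"
          by (rule cinner_Cauchy_Schwarz)
        also have "\<dots> \<le> (norm u * B) * norm v"
          by (intro mult_right_mono B) simp
        also have "\<dots> \<le> (D * B) * D"
          using that B(1) D by (intro mult_mono) auto
        finally show ?thesis .
      qed
      have "cmod (F x y) \<le> (C * B) * C + (C' * B) * C'" if "norm x \<le> R" "norm y \<le> R" for x y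
        unfolding F_def using that
        by (intro norm_triangle_le_diff add_mono kernel_bound C C')
      then show ?thesis by blast
    qed
    show "F x x = 0" if "x \<in> W" for x
      using diag[OF that] by (simp add: F_def)
  qed (use W in auto)
  then show ?thesis
    by (simp add: F_def)
qed

text \<open>
  If \<open>ev' v x\<close> is the value of \<open>v\<close> at \<open>\<sigma> x\<close> and
  \<open>\<sigma> x = g x\<close>, then the unitary operator \<open>T\<close> of the group element
  \<open>g\<close> satisfies \<open>ev' (T v) x = ev v x\<close>, and so \<open>T e\<^sub>x =
  e'\<^sub>x\<close>. Hence the kernel of an operator commuting with \<open>T\<close> takes the same value
  at \<open>(x, x)\<close> and \<open>(\<sigma> x, \<sigma> x)\<close>.
\<close>

lemma intertwiners_commute:
  fixes ev ev' :: "'v::complex_hilbert_space \<Rightarrow> complex ^ 'm::finite \<Rightarrow> complex"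
  assumes ev: "evaluation_family ev" "\<And>v. cholomorphic_on (ev v) UNIV"
    and ev': "evaluation_family ev'" "\<And>v. cholomorphic_on (\<lambda>x. cnj (ev' v x)) UNIV"
    and W: "open W" "W \<noteq> {}" and A: "bounded_operator A" and B: "bounded_operator B"
    and orbit: "\<And>x. x \<in> W \<Longrightarrow> \<exists>T. unitary_operator T \<and> A \<circ> T = T \<circ> A \<and> B \<circ> T = T \<circ> B \<and>
      (\<forall>v. ev' (T v) x = ev v x)"
  shows "A \<circ> B = B \<circ> A"
proof -
  obtain e where e: "\<And>v x. ev v x = cinner v (e x)"
      "\<And>R. \<exists>C. \<forall>x. norm x \<le> R \<longrightarrow> norm (e x) \<le> C" "\<And>v. (\<And>x. cinner v (e x) = 0) \<Longrightarrow> v = 0"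
    using evaluation_vectors[OF ev(1)] by blast
  obtain e' where e': "\<And>v x. ev' v x = cinner v (e' x)"
      "\<And>R. \<exists>C. \<forall>x. norm x \<le> R \<longrightarrow> norm (e' x) \<le> C" "\<And>v. (\<And>x. cinner v (e' x) = 0) \<Longrightarrow> v = 0"
    using evaluation_vectors[OF ev'(1)] by blast
  have sym: "cinner (X (e y)) (e x) = cinner (X (e' x)) (e' y)"
    if X: "bounded_operator X" and comm: "\<And>T. A \<circ> T = T \<circ> A \<Longrightarrow> B \<circ> T = T \<circ> B \<Longrightarrow> X \<circ> T = T \<circ> X"
    for X x y
  proof (rule kernel_symmetric_if_diagonal_invariant[OF _ _ e(2) e'(2) W X])
    show "cholomorphic_on (\<lambda>x. cinner v (e x)) UNIV" for v
      using ev(2)[of v] by (simp add: e(1)[abs_def])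
    show "cholomorphic_on (\<lambda>x. cnj (cinner v (e' x))) UNIV" for v
      using ev'(2)[of v] by (simp add: e'(1))
    fix x
    assume "x \<in> W"
    then obtain T where T: "unitary_operator T" "X \<circ> T = T \<circ> X" "\<And>v. ev' (T v) x = ev v x"
      using orbit comm by metis
    have "cinner (T v) (e' x) = cinner (T v) (T (e x))" for v
      using T by (metis e(1) e'(1) unitary_operator_def)
    moreover have "surj T"
      using T(1) by (simp add: unitary_operator_def)
    ultimately have "cinner w (e' x - T (e x)) = 0" for w
      using surjD[of T w] by (auto simp: cinner_diff_right)
    from this[of "e' x - T (e x)"] have "e' x = T (e x)"
      by simp
    then have "cinner (X (e' x)) (e' x) = cinner (T (X (e x))) (T (e x))"
      using T(2) by (metis o_apply)
    then show "cinner (X (e' x)) (e' x) = cinner (X (e x)) (e x)"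
      using T(1) by (simp add: unitary_operator_def)
  qed
  show ?thesis
  proof (rule bounded_operators_commute_if_kernels_symmetric[OF e(3) e'(3) A B])
    have "bounded_operator (id :: 'v \<Rightarrow> 'v)"
      by (simp add: bounded_operator_def id_def)
    from sym[OF this] show "cinner (e y) (e x) = cinner (e' x) (e' y)" for x y
      by simp
    show "cinner (A (e y)) (e x) = cinner (A (e' x)) (e' y)" for x y
      using sym[OF A] by blast
    show "cinner (B (e y)) (e x) = cinner (B (e' x)) (e' y)" for x y
      using sym[OF B] by blast
    have "(B \<circ> A) \<circ> T = T \<circ> (B \<circ> A)" if "A \<circ> T = T \<circ> A" "B \<circ> T = T \<circ> B" for T
      using that by (metis comp_assoc)
    from sym[OF bounded_operator_compose[OF B A] this]
    show "cinner (B (A (e y))) (e x) = cinner (B (A (e' x))) (e' y)" for x y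
      by simp
  qed
qed

section \<open>The homogeneous space\<close>

lemma carrier_heis_group [simp]: "carrier heis_group = UNIV"
  by (simp add: heis_group_def)

lemma one_heis_group [simp]: "\<one>\<^bsub>heis_group\<^esub> = 0"
  by (simp add: heis_group_def)

lemma complexify_mult:
  "complexify (u \<otimes>\<^bsub>real_heis\<^esub> v) = complexify u \<otimes>\<^bsub>complex_heis\<^esub> complexify v"
  by (simp add: heis_group_def heis_bracket_def complexify_def vec_eq_iff axis_def)

lemma complexify_0 [simp]: "complexify 0 = 0"
  by (simp add: complexify_def vec_eq_iff)

lemma l_coset_assoc:
  fixes M :: "(complex, 'n::finite) heis set"
  shows "x <#\<^bsub>complex_heis\<^esub> (y <#\<^bsub>complex_heis\<^esub> M) = (x \<otimes>\<^bsub>complex_heis\<^esub> y) <#\<^bsub>complex_heis\<^esub> M"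
  by (rule group.lcos_m_assoc[OF group_heis_group]) simp_all

lemma translate_hproj: "translate g (hproj H x) = hproj H (complexify g \<otimes>\<^bsub>complex_heis\<^esub> x)"
  by (simp add: translate_def hproj_def l_coset_assoc)

lemma translate_inv_translate: "translate (inv\<^bsub>real_heis\<^esub> g) (translate g p) = p"
proof -
  have "complexify (inv\<^bsub>real_heis\<^esub> g) \<otimes>\<^bsub>complex_heis\<^esub> complexify g = 0"
    by (simp add: complexify_mult[symmetric] group.l_inv[OF group_heis_group])
  then show ?thesis
    using group.lcos_mult_one[OF group_heis_group, of p] by (simp add: translate_def l_coset_assoc)
qed

lemma translate_0 [simp]: "translate 0 p = p"
  using group.lcos_mult_one[OF group_heis_group, of p] by (simp add: translate_def)

lemma hspace_eq_range: "hspace H = range (hproj H)"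
  by (auto simp: hspace_def LCOSETS_def hproj_def)

lemma translate_in_hspace: "p \<in> hspace H \<Longrightarrow> translate g p \<in> hspace H"
  by (auto simp: hspace_eq_range translate_hproj)

lemma topspace_hspace_topology [simp]: "topspace (hspace_topology H) = hspace H"
proof
  show "topspace (hspace_topology H) \<subseteq> hspace H"
    using openin_hspace_topology[of H "topspace (hspace_topology H)"] by simp
  have "hproj H -` hspace H = UNIV"
    by (auto simp: hspace_eq_range)
  then show "hspace H \<subseteq> topspace (hspace_topology H)"
    by (intro openin_subset) (simp add: openin_hspace_topology)
qed

lemma continuous_map_hproj: "continuous_map euclidean (hspace_topology H) (hproj H)"
  by (auto simp: continuous_map_def openin_hspace_topology hspace_eq_range vimage_def)

lemma compactin_hproj_cball: "compactin (hspace_topology H) (hproj H ` cball 0 R)"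
  by (rule image_compactin[OF _ continuous_map_hproj]) simp

text \<open>
  Continuity at \<open>0\<close> for the topology of uniform convergence on compact sets, in quantitative
  form.
\<close>

lemma continuous_realization_bounded_on_compact:
  fixes \<Phi> :: "'v::complex_hilbert_space \<Rightarrow> 'n::finite hpoint \<Rightarrow> complex"
  assumes cont: "continuous_map euclidean (uniform_on_compacts_topology H) \<Phi>"
    and hol: "\<And>v. \<Phi> v \<in> hol_functions H (hspace H)"
    and scale: "\<And>c v p. p \<in> hspace H \<Longrightarrow> \<Phi> (c *\<^sub>C v) p = c * \<Phi> v p"
    and K: "compactin (hspace_topology H) K"
  obtains C where "\<And>p v. p \<in> K \<Longrightarrow> cmod (\<Phi> v p) \<le> C * norm v"
proof -
  define N where "N = {f \<in> hol_functions H (hspace H). \<forall>p\<in>K. cmod (f p - \<Phi> 0 p) < 1}"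
  have Ksub: "K \<subseteq> hspace H"
    using compactin_subset_topspace[OF K] by simp
  have zero: "\<Phi> 0 p = 0" if "p \<in> hspace H" for p
  proof -
    have "0 *\<^sub>C (0 :: 'v) = 0"
      using scaleR_scaleC[of 0 "0 :: 'v"] by simp
    then show ?thesis
      using scale[OF that, of 0 0] by simp
  qed
  have "openin (uniform_on_compacts_topology H) N"
    unfolding uniform_on_compacts_topology_def openin_topology_generated_by_iff
  proof (rule generate_topology_on.Basis, clarify)
    show "\<exists>f0 K' e. N = {f \<in> hol_functions H (hspace H). \<forall>p\<in>K'. cmod (f p - f0 p) < e} \<and>
        f0 \<in> hol_functions H (hspace H) \<and> compactin (hspace_topology H) K' \<and> 0 < e"
      using K hol[of 0] by (intro exI[of _ "\<Phi> 0"] exI[of _ K] exI[of _ 1]) (simp add: N_def)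
  qed
  then have "open {v. \<Phi> v \<in> N}"
    using cont by (simp add: continuous_map_def)
  moreover have "0 \<in> {v. \<Phi> v \<in> N}"
    using hol by (simp add: N_def)
  ultimately obtain d where d: "d > 0" "cball 0 d \<subseteq> {v. \<Phi> v \<in> N}"
    using open_contains_cball by blast
  have "cmod (\<Phi> v p) \<le> (1 / d) * norm v" if p: "p \<in> K" for p v
  proof (cases "v = 0")
    case True
    then show ?thesis
      using zero p Ksub by auto
  next
    case False
    define c where "c = d / norm v"
    have c: "c > 0"
      using False d by (simp add: c_def)
    have "norm (complex_of_real c *\<^sub>C v) = d"
      using False d by (simp add: norm_scaleC c_def norm_divide)
    then have "complex_of_real c *\<^sub>C v \<in> cball 0 d"
      by simp
    then have "cmod (\<Phi> (complex_of_real c *\<^sub>C v) p) < 1"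
      using d(2) p Ksub zero unfolding N_def by fastforce
    then have "c * cmod (\<Phi> v p) < 1"
      using p Ksub c by (auto simp: scale subset_iff norm_mult)
    then have "cmod (\<Phi> v p) < 1 / c"
      using c by (simp add: field_simps)
    then show ?thesis
      by (simp add: c_def)
  qed
  then show ?thesis
    by (rule that)
qed

text \<open>
  The propagation theorem for the trivial line bundle. Everything is pulled back along \<open>hproj
  H\<close> to \<open>\<complex>\<^sup>2\<^sup>n\<^sup>+\<^sup>1\<close>, where the identity theorem is
  available without charts.
\<close>

theorem multiplicity_free_if_orbits_preserved:
  fixes H L :: "(real, 'n::finite) heis set"
  assumes \<sigma>: "antiholomorphic_map H \<sigma>" "\<sigma> ` hspace H = hspace H"
    and W: "open W" "W \<noteq> {}"
    and orbit: "\<And>x. x \<in> W \<Longrightarrow> \<sigma> (hproj H x) \<in> orbit_of L (hproj H x)"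
  shows "multiplicity_free TYPE('v::complex_hilbert_space) H L (hrep H)"
  unfolding multiplicity_free_def multiplicity_free_unitary_def
proof (intro allI impI ballI, elim conjE)
  fix \<tau> :: "(real, 'n) heis \<Rightarrow> 'v \<Rightarrow> 'v" and A B
  assume \<tau>: "unitary_rep L \<tau>" and "realized_in H L (hrep H) \<tau>"
    and A: "A \<in> intertwining_operators L \<tau>" and B: "B \<in> intertwining_operators L \<tau>"
  then obtain \<Phi> :: "'v \<Rightarrow> 'n hpoint \<Rightarrow> complex" where \<Phi>: "inj \<Phi>"
      "continuous_map euclidean (uniform_on_compacts_topology H) \<Phi>"
    and add: "\<And>u v p. p \<in> hspace H \<Longrightarrow> \<Phi> (u + v) p = \<Phi> u p + \<Phi> v p"
    and scale: "\<And>c v p. p \<in> hspace H \<Longrightarrow> \<Phi> (c *\<^sub>C v) p = c * \<Phi> v p"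
    and equivariant: "\<And>g v. g \<in> L \<Longrightarrow> \<Phi> (\<tau> g v) = hrep H g (\<Phi> v)"
    unfolding realized_in_def by metis
  have hol: "\<Phi> v \<in> hol_functions H (hspace H)" for v
  proof -
    have "\<Phi> v \<in> topspace (uniform_on_compacts_topology H)"
      using \<Phi>(2) by (auto simp: continuous_map_def)
    then show ?thesis
      unfolding uniform_on_compacts_topology_def topology_generated_by_topspace by auto
  qed
  have \<sigma>_in: "\<sigma> p \<in> hspace H" if "p \<in> hspace H" for p
    using that \<sigma>(2) by blast
  have hproj_in: "hproj H x \<in> hspace H" for x
    by (simp add: hspace_eq_range)
  have family: "evaluation_family (\<lambda>v x. \<Phi> v (s (hproj H x)))"
    if s: "continuous_map (hspace_topology H) (hspace_topology H) s" "s ` hspace H = hspace H" for s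
    unfolding evaluation_family_def
  proof (intro conjI allI impI)
    have s_in: "s (hproj H x) \<in> hspace H" for x
      using s(2) hproj_in by blast
    show "\<Phi> (u + v) (s (hproj H x)) = \<Phi> u (s (hproj H x)) + \<Phi> v (s (hproj H x))" for u v x
      by (intro add s_in)
    show "\<Phi> (c *\<^sub>C v) (s (hproj H x)) = c * \<Phi> v (s (hproj H x))" for c v x
      by (intro scale s_in)
    show "\<exists>C. \<forall>x v. norm x \<le> R \<longrightarrow> cmod (\<Phi> v (s (hproj H x))) \<le> C * norm v" for R
    proof -
      have "compactin (hspace_topology H) (s ` hproj H ` cball 0 R)"
        by (rule image_compactin[OF compactin_hproj_cball s(1)])
      then obtain C where "\<And>p v. p \<in> s ` hproj H ` cball 0 R \<Longrightarrow> cmod (\<Phi> v p) \<le> C * norm v"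
        using continuous_realization_bounded_on_compact[OF \<Phi>(2) hol scale] by blast
      then show ?thesis
        by (intro exI[of _ C]) auto
    qed
    show "v = 0" if v: "\<forall>x. \<Phi> v (s (hproj H x)) = 0" for v
    proof -
      have 0: "\<Phi> 0 p = 0" if "p \<in> hspace H" for p
        using add[OF that, of 0 0] by simp
      have "\<Phi> v p = \<Phi> 0 p" if "p \<in> hspace H" for p
      proof -
        have "p \<in> s ` hspace H"
          using that s(2) by simp
        then obtain x where "p = s (hproj H x)"
          unfolding hspace_eq_range by blast
        then show ?thesis
          using v 0[OF that] by simp
      qed
      then have "\<Phi> v = \<Phi> 0"
        using hol unfolding hol_functions_def by (intro extensionalityI[of _ "hspace H"]) auto
      then show ?thesis
        using \<Phi>(1) by (simp add: inj_eq)
    qed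
  qed
  have cholomorphic_lift: "cholomorphic_on (\<lambda>x. f (hproj H x)) UNIV" if "f \<in> hol_functions H (hspace H)" for f
  proof -
    have "hproj H -` hspace H = UNIV"
      using hproj_in by blast
    then show ?thesis
      using that by (simp add: hol_functions_def)
  qed
  show "A \<circ> B = B \<circ> A"
  proof (rule intertwiners_commute[OF _ _ _ _ W])
    show "evaluation_family (\<lambda>v x. \<Phi> v (hproj H x))"
      using family[of "\<lambda>p. p"] by (simp add: continuous_map_id[unfolded id_def])
    show "evaluation_family (\<lambda>v x. \<Phi> v (\<sigma> (hproj H x)))"
      using family[of \<sigma>] \<sigma> by (simp add: antiholomorphic_map_def)
    show "cholomorphic_on (\<lambda>x. \<Phi> v (hproj H x)) UNIV" for v
      by (rule cholomorphic_lift[OF hol])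
    show "cholomorphic_on (\<lambda>x. cnj (\<Phi> v (\<sigma> (hproj H x)))) UNIV" for v
    proof -
      have "openin (hspace_topology H) (hspace H)"
        using openin_topspace[of "hspace_topology H"] by simp
      then have "(\<lambda>p\<in>{p \<in> hspace H. \<sigma> p \<in> hspace H}. cnj (\<Phi> v (\<sigma> p)))
          \<in> hol_functions H {p \<in> hspace H. \<sigma> p \<in> hspace H}"
        using \<sigma>(1) hol unfolding antiholomorphic_map_def by blast
      moreover have "{p \<in> hspace H. \<sigma> p \<in> hspace H} = hspace H"
        using \<sigma>_in by blast
      ultimately show ?thesis
        using cholomorphic_lift[of "\<lambda>p\<in>hspace H. cnj (\<Phi> v (\<sigma> p))"] hproj_in by simp
    qed
    show "bounded_operator A" "bounded_operator B"
      using A B by (auto simp: intertwining_operators_def)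
    fix x
    assume "x \<in> W"
    then obtain g where g: "g \<in> L" "\<sigma> (hproj H x) = translate g (hproj H x)"
      using orbit unfolding orbit_of_def by blast
    have "\<Phi> (\<tau> g v) (\<sigma> (hproj H x)) = \<Phi> v (hproj H x)" for v
      using g translate_in_hspace[OF hproj_in]
      by (simp add: equivariant hrep_def translate_inv_translate)
    then show "\<exists>T. unitary_operator T \<and> A \<circ> T = T \<circ> A \<and> B \<circ> T = T \<circ> B \<and>
        (\<forall>v. \<Phi> (T v) (\<sigma> (hproj H x)) = \<Phi> v (hproj H x))"
      using g \<tau> A B by (auto simp: unitary_rep_def intertwining_operators_def)
  qed
qed

theorem multiplicity_free_if_strongly_visible:
  fixes H L :: "(real, 'n::finite) heis set"
  assumes L: "subgroup L real_heis" and "strongly_visible H L"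
  shows "multiplicity_free TYPE('v::complex_hilbert_space) H L (hrep H)"
proof -
  obtain S \<sigma> where \<sigma>: "antiholomorphic_diffeo H \<sigma>"
    and D: "(\<Union>p\<in>S. orbit_of L p) \<noteq> {}" "openin (hspace_topology H) (\<Union>p\<in>S. orbit_of L p)"
    and orbit: "\<forall>p\<in>(\<Union>p\<in>S. orbit_of L p). \<sigma> ` orbit_of L p \<subseteq> orbit_of L p"
    using assms(2) unfolding strongly_visible_def Let_def by (elim exE conjE) (rule that; assumption)
  define D' where "D' = (\<Union>p\<in>S. orbit_of L p)"
  show ?thesis
  proof (rule multiplicity_free_if_orbits_preserved)
    show "antiholomorphic_map H \<sigma>" "\<sigma> ` hspace H = hspace H"
      using \<sigma> by (auto simp: antiholomorphic_diffeo_def bij_betw_def)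
    show "open (hproj H -` D')"
      using D(2) by (simp add: D'_def openin_hspace_topology)
    show "hproj H -` D' \<noteq> {}"
      using D by (auto simp: D'_def openin_hspace_topology hspace_eq_range)
    have self: "p \<in> orbit_of L p" for p
      unfolding orbit_of_def using subgroup.one_closed[OF L] by (intro image_eqI[of _ _ 0]) simp_all
    show "\<sigma> (hproj H x) \<in> orbit_of L (hproj H x)" if "x \<in> hproj H -` D'" for x
    proof -
      have "\<sigma> ` orbit_of L (hproj H x) \<subseteq> orbit_of L (hproj H x)"
        using that by (intro bspec[OF orbit]) (simp add: D'_def)
      then show ?thesis
        using self by blast
    qed
  qed
qed

section \<open>Connected subgroups and their Lie algebras\<close>

text \<open>
  The coefficient of the bracket: the standard symplectic form, extended by zero on the centre.
\<close>

definition heis_form :: "('k::field, 'n::finite) heis \<Rightarrow> ('k, 'n) heis \<Rightarrow> 'k" where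
  "heis_form u v = (\<Sum>i\<in>UNIV. u $ Xi i * v $ Yi i - u $ Yi i * v $ Xi i)"

lemma heis_bracket_eq: "heis_bracket u v = heis_form u v *s axis Zi 1"
  by (simp add: heis_bracket_def heis_form_def)

lemma heis_mult_eq: "u \<otimes>\<^bsub>heis_group\<^esub> v = u + v + (heis_form u v / 2) *s axis Zi 1"
  by (simp add: heis_group_def heis_bracket_eq)

lemma heis_form_add_left: "heis_form (u + v) w = heis_form u w + heis_form v w"
  by (simp add: heis_form_def sum.distrib[symmetric] algebra_simps)

lemma heis_form_add_right: "heis_form w (u + v) = heis_form w u + heis_form w v"
  by (simp add: heis_form_def sum.distrib[symmetric] algebra_simps)

lemma heis_form_scale_left: "heis_form (c *s u) v = c * heis_form u v"
  by (simp add: heis_form_def sum_distrib_left algebra_simps)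

lemma heis_form_scale_right: "heis_form u (c *s v) = c * heis_form u v"
  by (simp add: heis_form_def sum_distrib_left algebra_simps)

lemma heis_form_minus_left: "heis_form (- u) v = - heis_form u v"
  by (simp add: heis_form_def flip: sum_negf)

lemma heis_form_minus_right: "heis_form u (- v) = - heis_form u v"
  by (simp add: heis_form_def flip: sum_negf)

lemma heis_form_diff_left: "heis_form (u - v) w = heis_form u w - heis_form v w"
  using heis_form_add_left[of u "- v" w] by (simp add: heis_form_minus_left)

lemma heis_form_diff_right: "heis_form w (u - v) = heis_form w u - heis_form w v"
  using heis_form_add_right[of w u "- v"] by (simp add: heis_form_minus_right)

lemma heis_form_swap: "heis_form u v = - heis_form v u"
  by (simp add: heis_form_def algebra_simps flip: sum_negf)

lemma heis_form_self [simp]: "heis_form u u = 0"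
  by (simp add: heis_form_def mult.commute)

lemma heis_form_center [simp]: "heis_form (axis Zi 1) v = 0" "heis_form u (axis Zi 1) = 0"
  by (simp_all add: heis_form_def axis_def)

lemma heis_form_0 [simp]: "heis_form 0 v = 0" "heis_form u 0 = 0"
  by (simp_all add: heis_form_def)

lemmas heis_form_linear = heis_form_add_left heis_form_add_right heis_form_scale_left
  heis_form_scale_right heis_form_minus_left heis_form_minus_right
  heis_form_diff_left heis_form_diff_right

lemma heis_inv_eq: "inv\<^bsub>heis_group\<^esub> u = - u"
  by (rule group.inv_equality[OF group_heis_group]) (simp_all add: heis_mult_eq heis_form_linear)

lemma subgroup_heis_closed:
  assumes "subgroup H real_heis"
  shows "0 \<in> H" "u \<in> H \<Longrightarrow> - u \<in> H"
    "u \<in> H \<Longrightarrow> v \<in> H \<Longrightarrow> u + v + (heis_form u v / 2) *\<^sub>R axis Zi 1 \<in> H"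
  using subgroup.one_closed[OF assms] subgroup.m_inv_closed[OF assms, of u]
    subgroup.m_closed[OF assms, of u v]
  by (simp_all add: heis_inv_eq heis_mult_eq scalar_mult_eq_scaleR)

lemma subgroup_heis_of_int_multiple:
  assumes H: "subgroup H real_heis" and u: "u \<in> H"
  shows "of_int k *\<^sub>R u \<in> H"
proof -
  have nat: "of_nat m *\<^sub>R u \<in> H" for m
  proof (induction m)
    case (Suc m)
    then show ?case
      using subgroup_heis_closed(3)[OF H u Suc]
      by (simp add: heis_form_scale_right algebra_simps flip: scalar_mult_eq_scaleR)
  qed (simp add: subgroup_heis_closed[OF H])
  show ?thesis
  proof (cases k)
    case (neg m)
    then show ?thesis
      using subgroup_heis_closed(2)[OF H nat[of "Suc m"]] by (simp flip: scaleR_minus_left)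
  qed (simp add: nat)
qed

text \<open>
  The commutator of the group elements \<open>t u\<close> and \<open>v\<close> is \<open>t [u, v]\<close>;
  it is computed here as the product of \<open>(t u) v\<close> and \<open>(- t u) (- v)\<close>.
\<close>

lemma lie_algebra_bracket_closed:
  assumes H: "subgroup H real_heis" and u: "u \<in> lie_algebra_of H" and v: "v \<in> lie_algebra_of H"
  shows "heis_form u v *\<^sub>R axis Zi 1 \<in> lie_algebra_of H"
  unfolding lie_algebra_of_def
proof (intro CollectI allI)
  fix t
  define a where "a = t *\<^sub>R u"
  have "a \<in> H" "v \<in> H" "- a \<in> H" "- v \<in> H"
    using u v subgroup_heis_closed(2)[OF H] by (auto simp: a_def lie_algebra_of_def dest: spec[of _ 1])
  define c where "c = heis_form a v / 2"
  define p where "p = a + v + c *\<^sub>R axis Zi 1"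
  define q where "q = - a + - v + c *\<^sub>R axis Zi 1"
  have "p \<in> H" "q \<in> H"
    using subgroup_heis_closed(3)[OF H \<open>a \<in> H\<close> \<open>v \<in> H\<close>]
      subgroup_heis_closed(3)[OF H \<open>- a \<in> H\<close> \<open>- v \<in> H\<close>]
    by (simp_all add: p_def q_def c_def heis_form_linear)
  then have "p + q + (heis_form p q / 2) *\<^sub>R axis Zi 1 \<in> H"
    by (rule subgroup_heis_closed(3)[OF H])
  moreover have "heis_form p q = 0"
    using heis_form_swap[of v a]
    by (simp add: p_def q_def heis_form_linear flip: scalar_mult_eq_scaleR)
  moreover have "p + q = (c + c) *\<^sub>R axis Zi 1"
    unfolding p_def q_def scaleR_add_left by (simp only: add_ac) simp
  ultimately have "heis_form a v *\<^sub>R axis Zi 1 \<in> H"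
    by (simp add: c_def)
  then show "t *\<^sub>R heis_form u v *\<^sub>R axis Zi 1 \<in> H"
    by (simp add: a_def heis_form_linear flip: scalar_mult_eq_scaleR)
qed

text \<open>
  The product \<open>(t u) (t v)\<close> differs from \<open>t (u + v)\<close> only by half the bracket
  \<open>[t u, t v]\<close>, which is central and belongs to the Lie algebra. So closure under addition
  holds without a limit argument.
\<close>

lemma subspace_lie_algebra:
  assumes H: "subgroup H real_heis"
  shows "subspace (lie_algebra_of H)"
proof (rule subspaceI)
  show "0 \<in> lie_algebra_of H"
    using subgroup_heis_closed(1)[OF H] by (simp add: lie_algebra_of_def)
  show "c *\<^sub>R u \<in> lie_algebra_of H" if "u \<in> lie_algebra_of H" for c u
    using that by (simp add: lie_algebra_of_def)
  show "u + v \<in> lie_algebra_of H" if u: "u \<in> lie_algebra_of H" and v: "v \<in> lie_algebra_of H" for u v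
    unfolding lie_algebra_of_def
  proof (intro CollectI allI)
    fix t
    \<comment> \<open>The factors are the group product of \<open>t u\<close> and \<open>t v\<close> and the central element that corrects it.\<close>
    define w where "w = t *\<^sub>R u + t *\<^sub>R v + (heis_form (t *\<^sub>R u) (t *\<^sub>R v) / 2) *\<^sub>R axis Zi 1"
    define z :: "(real, 'a) heis" where "z = (- t * t / 2) *\<^sub>R heis_form u v *\<^sub>R axis Zi 1"
    have "w \<in> H"
      unfolding w_def using u v by (intro subgroup_heis_closed(3)[OF H]) (simp_all add: lie_algebra_of_def)
    moreover have "z \<in> H"
      using lie_algebra_bracket_closed[OF H u v] unfolding lie_algebra_of_def z_def by blast
    ultimately have "w + z + (heis_form w z / 2) *\<^sub>R axis Zi 1 \<in> H"
      by (rule subgroup_heis_closed(3)[OF H])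
    moreover have "heis_form w z = 0"
      by (simp add: z_def heis_form_linear flip: scalar_mult_eq_scaleR)
    moreover have "w + z = t *\<^sub>R (u + v)"
      by (simp add: w_def z_def heis_form_linear algebra_simps flip: scalar_mult_eq_scaleR)
    ultimately show "t *\<^sub>R (u + v) \<in> H"
      by simp
  qed
qed

text \<open>
  If \<open>h\<^sub>k \<rightarrow> 0\<close>, the integer multiples of \<open>h\<^sub>k\<close> are
  increasingly dense in the line through \<open>h\<^sub>k\<close>, and they are powers in the group. So
  every point of the limiting line is a limit of elements of \<open>H\<close>.
\<close>

lemma limit_direction_in_lie_algebra:
  assumes H: "subgroup H real_heis" "closed H"
    and h: "\<And>k. h k \<in> H" "\<And>k. h k \<noteq> 0" "h \<longlonglongrightarrow> 0"
    and u: "(\<lambda>k. (1 / norm (h k)) *\<^sub>R h k) \<longlonglongrightarrow> u"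
  shows "u \<in> lie_algebra_of H"
  unfolding lie_algebra_of_def
proof (intro CollectI allI)
  fix t
  \<comment> \<open>With this choice \<open>m k\<close> times \<open>h k\<close> is within \<open>norm (h k)\<close> of \<open>t\<close> times the normalized vector.\<close>
  define m where "m k = \<lfloor>t / norm (h k)\<rfloor>" for k
  have "(\<lambda>k. of_int (m k) *\<^sub>R h k - t *\<^sub>R ((1 / norm (h k)) *\<^sub>R h k)) \<longlonglongrightarrow> 0"
  proof (rule Lim_null_comparison[OF _ tendsto_norm_zero[OF h(3)]])
    have "norm (of_int (m k) *\<^sub>R h k - t *\<^sub>R ((1 / norm (h k)) *\<^sub>R h k)) \<le> norm (h k)" for k
    proof -
      have "\<bar>of_int (m k) - t / norm (h k)\<bar> \<le> 1"
        unfolding m_def by linarith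
      then have "\<bar>of_int (m k) - t / norm (h k)\<bar> * norm (h k) \<le> norm (h k)"
        by (rule mult_left_le_one_le[rotated 2]) simp_all
      moreover have "of_int (m k) *\<^sub>R h k - t *\<^sub>R ((1 / norm (h k)) *\<^sub>R h k) =
          (of_int (m k) - t / norm (h k)) *\<^sub>R h k"
        by (simp add: scaleR_diff_left)
      ultimately show ?thesis
        by simp
    qed
    then show "\<forall>\<^sub>F k in sequentially. norm (of_int (m k) *\<^sub>R h k - t *\<^sub>R ((1 / norm (h k)) *\<^sub>R h k)) \<le> norm (h k)"
      by simp
  qed
  from tendsto_add[OF this tendsto_scaleR[OF tendsto_const[of t] u]]
  have "(\<lambda>k. of_int (m k) *\<^sub>R h k) \<longlonglongrightarrow> t *\<^sub>R u"
    by simp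
  then show "t *\<^sub>R u \<in> H"
    using closed_sequentially[OF H(2), of "\<lambda>k. of_int (m k) *\<^sub>R h k"] subgroup_heis_of_int_multiple[OF H(1) h(1)] by blast
qed

text \<open>
  If the identity is isolated in \<open>H\<close>, connectedness makes \<open>H\<close> trivial; otherwise a
  limit of normalized elements tending to \<open>0\<close> lies in the Lie algebra.
\<close>

lemma lie_algebra_nontrivial:
  fixes H :: "(real, 'n::finite) heis set"
  assumes H: "connected_closed_subgroup H" and nontriv: "H \<noteq> {0}"
  shows "\<exists>u\<in>lie_algebra_of H. u \<noteq> 0"
proof -
  have sub: "subgroup H real_heis" and cl: "closed H" and conn: "connected H"
    using H by (auto simp: connected_closed_subgroup_def)
  have "\<exists>h\<in>H. h \<noteq> 0 \<and> norm h < e" if e: "e > 0" for e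
  proof (rule ccontr)
    assume "\<not> ?thesis"
    then have "{0} = H \<inter> ball 0 e"
      using subgroup_heis_closed(1)[OF sub] e by auto
    then have "openin (top_of_set H) {0}"
      by (metis openin_open_Int open_ball)
    moreover have "closedin (top_of_set H) {0}"
      using subgroup_heis_closed(1)[OF sub] by (simp add: closedin_closed_subset)
    ultimately have "{0} = H"
      using conn unfolding connected_clopen by blast
    then show False
      using nontriv by simp
  qed
  then have "\<exists>h\<in>H. h \<noteq> 0 \<and> norm h < inverse (real (Suc k))" for k
    by simp
  then obtain h where h: "\<And>k. h k \<in> H" "\<And>k. h k \<noteq> 0" "\<And>k. norm (h k) < inverse (real (Suc k))"
    by metis
  have "h \<longlonglongrightarrow> 0"
  proof (rule Lim_null_comparison[OF _ LIMSEQ_inverse_real_of_nat])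
    show "\<forall>\<^sub>F k in sequentially. norm (h k) \<le> inverse (real (Suc k))"
      using h(3) by (simp add: less_imp_le)
  qed
  have "seq_compact (sphere (0 :: (real, 'n) heis) 1)"
    by (simp add: compact_imp_seq_compact)
  moreover have "\<forall>k. (1 / norm (h k)) *\<^sub>R h k \<in> sphere 0 1"
    using h(2) by simp
  ultimately obtain u r where u: "u \<in> sphere (0 :: (real, 'n) heis) 1" "strict_mono (r :: nat \<Rightarrow> nat)"
      "((\<lambda>k. (1 / norm (h k)) *\<^sub>R h k) \<circ> r) \<longlonglongrightarrow> u"
    by (rule seq_compactE)
  have "u \<in> lie_algebra_of H"
  proof (rule limit_direction_in_lie_algebra[OF sub cl])
    show "(h \<circ> r) k \<in> H" "(h \<circ> r) k \<noteq> 0" for k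
      using h by auto
    show "(h \<circ> r) \<longlonglongrightarrow> 0"
      using LIMSEQ_subseq_LIMSEQ[OF \<open>h \<longlonglongrightarrow> 0\<close> u(2)] .
    show "(\<lambda>k. (1 / norm ((h \<circ> r) k)) *\<^sub>R (h \<circ> r) k) \<longlonglongrightarrow> u"
      using u(3) by (simp add: o_def)
  qed
  then show ?thesis
    using u(1) by (intro bexI[of _ u]) auto
qed

section \<open>An anti-holomorphic involution preserving the orbits of the Heisenberg group\<close>

definition conj_heis :: "(complex, 'n::finite) heis \<Rightarrow> (complex, 'n) heis" where
  "conj_heis u = (\<chi> i. cnj (u $ i))"

text \<open>
  The complex-linear extension of the functional \<open>w \<mapsto> q \<bullet> w\<close>.
\<close>

definition functional :: "(real, 'n::finite) heis \<Rightarrow> (complex, 'n) heis \<Rightarrow> complex" where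
  "functional q u = (\<Sum>i\<in>UNIV. complex_of_real (q $ i) * u $ i)"

text \<open>
  When \<open>q $ Zi = 1\<close>, this fixes the central basis vector and is \<open>u \<mapsto> - cnj
  u\<close> on the kernel of the functional. It is then an antilinear involutive automorphism of the group.
  On the coordinates along the \<open>X\<^sub>i\<close> and \<open>Y\<^sub>i\<close> it preserves imaginary
  parts, which for generic points are, modulo the subgroup, the only invariants of the orbits of the real
  group. The freedom in \<open>q\<close> serves to make the automorphism preserve the given subgroup.
\<close>

definition reflection :: "(real, 'n::finite) heis \<Rightarrow> (complex, 'n) heis \<Rightarrow> (complex, 'n) heis" where
  "reflection q u = - conj_heis u + (2 * functional q (conj_heis u)) *s axis Zi 1"

lemma conj_heis_simps [simp]:
  "conj_heis (u + v) = conj_heis u + conj_heis v" "conj_heis (- u) = - conj_heis u"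
  "conj_heis (u - v) = conj_heis u - conj_heis v"
  "conj_heis (c *s u) = cnj c *s conj_heis u" "conj_heis (conj_heis u) = u"
  "conj_heis (axis Zi 1) = axis Zi 1" "conj_heis (complexify w) = complexify w"
  by (simp_all add: conj_heis_def complexify_def vec_eq_iff axis_def)

lemma heis_form_conj_heis: "heis_form (conj_heis u) (conj_heis v) = cnj (heis_form u v)"
  by (simp add: heis_form_def conj_heis_def)

lemma functional_simps [simp]:
  "functional q (u + v) = functional q u + functional q v" "functional q (- u) = - functional q u"
  "functional q (u - v) = functional q u - functional q v" "functional q (c *s u) = c * functional q u"
  "functional q (complexify w) = complex_of_real (q \<bullet> w)"
  by (simp_all add: functional_def complexify_def inner_vec_def sum.distrib[symmetric]
    sum_negf[symmetric] sum_subtractf[symmetric] sum_distrib_left algebra_simps)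

lemma functional_center [simp]: "functional q (axis Zi 1) = complex_of_real (q $ Zi)"
  unfolding functional_def by (subst sum.remove[of _ Zi]) (auto simp: axis_def intro: sum.neutral)

lemma functional_conj_heis: "functional q (conj_heis u) = cnj (functional q u)"
  by (simp add: functional_def conj_heis_def)

lemma complexify_simps:
  "complexify (u + v) = complexify u + complexify v" "complexify (r *\<^sub>R u) = complex_of_real r *s complexify u"
  "complexify (- u) = - complexify u" "complexify (u - v) = complexify u - complexify v"
  "complexify (axis Zi 1) = axis Zi 1"
  by (simp_all add: complexify_def vec_eq_iff axis_def)

lemma heis_form_complexify: "heis_form (complexify u) (complexify v) = complex_of_real (heis_form u v)"
  by (simp add: heis_form_def complexify_def)

lemma reflection_add: "reflection q (u + v) = reflection q u + reflection q v"
  by (simp add: reflection_def algebra_simps vec.scale_left_distrib)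

lemma reflection_scale: "reflection q (c *s u) = cnj c *s reflection q u"
  by (simp add: reflection_def algebra_simps vec.scale_right_diff_distrib)

lemma bounded_linear_reflection: "bounded_linear (reflection q)"
proof (intro linear_conv_bounded_linear[THEN iffD1] linearI)
  show "reflection q (r *\<^sub>R u) = r *\<^sub>R reflection q u" for r u
  proof -
    have scaleR: "r *\<^sub>R v = complex_of_real r *s v" for v :: "(complex, 'a) heis"
      by (simp add: vec_eq_iff) (simp add: scaleR_conv_of_real)
    show ?thesis
      unfolding scaleR reflection_scale by simp
  qed
qed (rule reflection_add)

lemma reflection_center: "q $ Zi = 1 \<Longrightarrow> reflection q (axis Zi 1) = axis Zi 1"
  by (simp add: reflection_def vec_eq_iff)

lemma reflection_involution: "q $ Zi = 1 \<Longrightarrow> reflection q (reflection q u) = u"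
  by (simp add: reflection_def functional_conj_heis algebra_simps flip: vec.scale_left_distrib)

lemma reflection_mult:
  assumes q: "q $ Zi = 1"
  shows "reflection q (u \<otimes>\<^bsub>complex_heis\<^esub> v) = reflection q u \<otimes>\<^bsub>complex_heis\<^esub> reflection q v"
proof -
  have "heis_form (reflection q u) (reflection q v) = cnj (heis_form u v)"
    by (simp add: reflection_def heis_form_linear heis_form_conj_heis)
  then show ?thesis
    by (simp add: heis_mult_eq reflection_add reflection_scale reflection_center[OF q])
qed

lemma subspace_complex_subgroup: "vec.subspace (complex_subgroup H)"
  by (simp add: complex_subgroup_def vec.subspace_span)

lemma complexify_in_complex_subgroup: "u \<in> lie_algebra_of H \<Longrightarrow> complexify u \<in> complex_subgroup H"
  by (simp add: complex_subgroup_def vec.span_base)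

text \<open>
  An element \<open>k\<close> of the subspace whose bracket with the subspace vanishes acts on it by the
  translation \<open>y \<mapsto> k + y\<close>.
\<close>

lemma hproj_mult_central:
  assumes k: "k \<in> complex_subgroup H" and central: "\<And>y. y \<in> complex_subgroup H \<Longrightarrow> heis_form k y = 0"
  shows "hproj H (x \<otimes>\<^bsub>complex_heis\<^esub> k) = hproj H x"
proof -
  have "k <#\<^bsub>complex_heis\<^esub> complex_subgroup H = (+) k ` complex_subgroup H"
    by (auto simp: l_coset_def heis_mult_eq central)
  also have "\<dots> = complex_subgroup H"
  proof
    show "(+) k ` complex_subgroup H \<subseteq> complex_subgroup H"
      using k by (auto intro: vec.subspace_add[OF subspace_complex_subgroup])
    show "complex_subgroup H \<subseteq> (+) k ` complex_subgroup H"
    proof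
      fix y assume "y \<in> complex_subgroup H"
      then have "y - k \<in> complex_subgroup H"
        using k by (rule vec.subspace_diff[OF subspace_complex_subgroup])
      then show "y \<in> (+) k ` complex_subgroup H"
        by (rule rev_image_eqI) simp
    qed
  qed
  finally show ?thesis
    by (simp add: hproj_def l_coset_assoc[symmetric])
qed

lemma reflection_image_complex_subgroup:
  assumes q: "q $ Zi = 1"
    and inv: "\<And>u. u \<in> lie_algebra_of H \<Longrightarrow> reflection q (complexify u) \<in> complex_subgroup H"
  shows "reflection q ` complex_subgroup H = complex_subgroup H"
proof -
  have "reflection q k \<in> complex_subgroup H" if "k \<in> complex_subgroup H" for k
    using that unfolding complex_subgroup_def
  proof (induction k rule: vec.span_induct_alt)
    case base
    then show ?case
      using reflection_scale[of q 0 0] by (simp add: vec.span_zero)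
  next
    case (step c x y)
    then obtain u where "x = complexify u" "u \<in> lie_algebra_of H"
      by blast
    then show ?case
      using inv[of u] step(2)
      by (auto simp: reflection_add reflection_scale complex_subgroup_def intro: vec.span_add vec.span_scale)
  qed
  then have sub: "reflection q ` complex_subgroup H \<subseteq> complex_subgroup H"
    by blast
  have "complex_subgroup H = reflection q ` reflection q ` complex_subgroup H"
    by (simp add: image_image reflection_involution[OF q])
  with sub show ?thesis
    by blast
qed

lemma reflection_image_hproj:
  assumes "q $ Zi = 1" and "reflection q ` complex_subgroup H = complex_subgroup H"
  shows "reflection q ` hproj H x = hproj H (reflection q x)"
proof -
  have "reflection q ` hproj H x = (\<Union>k\<in>complex_subgroup H. {reflection q x \<otimes>\<^bsub>complex_heis\<^esub> reflection q k})"
    unfolding hproj_def l_coset_def image_UN by (simp add: reflection_mult[OF assms(1)])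
  also have "\<dots> = (\<Union>k\<in>reflection q ` complex_subgroup H. {reflection q x \<otimes>\<^bsub>complex_heis\<^esub> k})"
    by blast
  finally show ?thesis
    by (simp add: assms(2) hproj_def l_coset_def)
qed

lemma antiholomorphic_map_reflection:
  assumes \<sigma>: "\<And>x. \<sigma> (hproj H x) = hproj H (reflection q x)"
  shows "antiholomorphic_map H \<sigma>"
proof -
  have cont: "continuous_on UNIV (reflection q)"
    by (intro linear_continuous_on bounded_linear_reflection)
  have preimage: "hproj H -` {p \<in> hspace H. \<sigma> p \<in> U} = reflection q -` (hproj H -` U)" for U
    by (auto simp: \<sigma> hspace_eq_range)
  have open_preimage: "open (hproj H -` {p \<in> hspace H. \<sigma> p \<in> U})" if "openin (hspace_topology H) U" for U
    unfolding preimage using that cont by (intro open_vimage) (simp_all add: openin_hspace_topology)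
  have "continuous_map (hspace_topology H) (hspace_topology H) \<sigma>"
    unfolding continuous_map_def
  proof (intro conjI allI impI)
    show "\<sigma> \<in> topspace (hspace_topology H) \<rightarrow> topspace (hspace_topology H)"
      by (auto simp: hspace_eq_range \<sigma>)
    show "openin (hspace_topology H) {p \<in> topspace (hspace_topology H). \<sigma> p \<in> U}"
      if "openin (hspace_topology H) U" for U
      using open_preimage[OF that] by (simp add: openin_hspace_topology)
  qed
  moreover have "(\<lambda>p\<in>{p \<in> hspace H. \<sigma> p \<in> U}. cnj (f (\<sigma> p))) \<in> hol_functions H {p \<in> hspace H. \<sigma> p \<in> U}"
    if U: "openin (hspace_topology H) U" and f: "f \<in> hol_functions H U" for U f
  proof -
    define P where "P = {p \<in> hspace H. \<sigma> p \<in> U}"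
    define g where "g = (\<lambda>p\<in>P. cnj (f (\<sigma> p)))"
    have "cholomorphic_on (\<lambda>x. g (hproj H x)) (hproj H -` P)"
      unfolding cholomorphic_on_def
    proof
      fix x assume x: "x \<in> hproj H -` P"
      then have "reflection q x \<in> hproj H -` U"
        by (simp add: P_def \<sigma>)
      then obtain f' where f': "((\<lambda>x. f (hproj H x)) has_derivative f') (at (reflection q x))"
          "\<And>c v. f' (c *s v) = c * f' v"
        using f unfolding hol_functions_def cholomorphic_on_def by blast
      have "((\<lambda>x. cnj (f (hproj H (reflection q x)))) has_derivative (\<lambda>v. cnj (f' (reflection q v)))) (at x)"
        by (intro bounded_linear.has_derivative[OF bounded_linear_cnj]
          has_derivative_compose[of "reflection q" "reflection q" x UNIV "\<lambda>x. f (hproj H x)" f']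
          bounded_linear_imp_has_derivative bounded_linear_reflection f'(1))
      moreover have "open (hproj H -` P)"
        using open_preimage[OF U] by (simp add: P_def)
      ultimately have "((\<lambda>x. g (hproj H x)) has_derivative (\<lambda>v. cnj (f' (reflection q v)))) (at x)"
        by (rule has_derivative_transform_within_open[OF _ _ x]) (simp add: g_def \<sigma>)
      moreover have "cnj (f' (reflection q (c *s v))) = c * cnj (f' (reflection q v))" for c v
        by (simp add: reflection_scale f'(2))
      ultimately show "\<exists>g'. ((\<lambda>x. g (hproj H x)) has_derivative g') (at x) \<and> (\<forall>c v. g' (c *s v) = c * g' v)"
        by blast
    qed
    then show ?thesis
      by (simp add: hol_functions_def P_def g_def)
  qed
  ultimately show ?thesis
    unfolding antiholomorphic_map_def by blast
qed

lemma orbit_of_hproj: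
  "orbit_of L (hproj H x) = (\<lambda>g. hproj H (complexify g \<otimes>\<^bsub>complex_heis\<^esub> x)) ` L"
  by (simp add: orbit_of_def translate_hproj)

lemma complex_heis_cases:
  obtains a b where "x = complexify a + \<i> *s complexify b"
proof
  show "x = complexify (\<chi> i. Re (x $ i)) + \<i> *s complexify (\<chi> i. Im (x $ i))"
    by (simp add: complexify_def vec_eq_iff complex_eq)
qed

text \<open>
  Here the action is by real translations on a quotient of \<open>\<complex>\<^sup>2\<^sup>n\<close>, and
  \<open>x \<mapsto> - cnj x\<close> is translation by \<open>- 2 Re x\<close>; the central coordinate is
  absorbed by the subgroup.
\<close>

lemma reflection_in_orbit_if_center_in_lie_algebra:
  assumes "axis Zi 1 \<in> lie_algebra_of H"
  shows "hproj H (reflection q x) \<in> orbit_of UNIV (hproj H x)"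
proof -
  obtain a b where x: "x = complexify a + \<i> *s complexify b"
    by (rule complex_heis_cases)
  define g where "g = - 2 *\<^sub>R a"
  define c where "c = 2 * functional q (conj_heis x) - heis_form (complexify g) x / 2"
  have "c *s axis Zi 1 \<in> complex_subgroup H"
    using complexify_in_complex_subgroup[OF assms]
    by (intro vec.subspace_scale[OF subspace_complex_subgroup]) (simp add: complexify_simps)
  then have "hproj H ((complexify g \<otimes>\<^bsub>complex_heis\<^esub> x) \<otimes>\<^bsub>complex_heis\<^esub> (c *s axis Zi 1)) =
      hproj H (complexify g \<otimes>\<^bsub>complex_heis\<^esub> x)"
    by (rule hproj_mult_central) (simp add: heis_form_linear)
  moreover have "(complexify g \<otimes>\<^bsub>complex_heis\<^esub> x) \<otimes>\<^bsub>complex_heis\<^esub> (c *s axis Zi 1) = reflection q x"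
  proof -
    have "complexify g + x = - conj_heis x"
      by (simp add: x g_def complexify_simps vec_eq_iff)
    moreover have "(complexify g \<otimes>\<^bsub>complex_heis\<^esub> x) \<otimes>\<^bsub>complex_heis\<^esub> (c *s axis Zi 1) =
        (complexify g + x) + (heis_form (complexify g) x / 2 + c) *s axis Zi 1"
      by (simp add: heis_mult_eq heis_form_linear vec.scale_left_distrib add.assoc)
    ultimately show ?thesis
      by (simp add: c_def reflection_def)
  qed
  ultimately show ?thesis
    unfolding orbit_of_hproj by (metis UNIV_I image_eqI)
qed

text \<open>
  A nonzero bracket would be a nonzero multiple of the central basis vector.
\<close>

lemma heis_form_lie_algebra_eq_0:
  assumes H: "subgroup H real_heis" and center: "axis Zi 1 \<notin> lie_algebra_of H"
    and u: "u \<in> lie_algebra_of H" and y: "y \<in> complex_subgroup H"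
  shows "heis_form (complexify u) y = 0"
  using y unfolding complex_subgroup_def
proof (induction y rule: vec.span_induct_alt)
  case (step c x y)
  then obtain v where v: "x = complexify v" "v \<in> lie_algebra_of H"
    by blast
  have "heis_form u v = 0"
  proof (rule ccontr)
    assume nz: "heis_form u v \<noteq> 0"
    have "(1 / heis_form u v) *\<^sub>R heis_form u v *\<^sub>R axis Zi 1 \<in> lie_algebra_of H"
      by (intro subspace_scale[OF subspace_lie_algebra[OF H]] lie_algebra_bracket_closed[OF H u v(2)])
    then show False
      using nz center by simp
  qed
  then show ?case
    using step(2) v(1) by (simp add: heis_form_linear heis_form_complexify)
qed simp

text \<open>
  Left translation by \<open>- 2 a\<close> produces the right coordinates along the \<open>X\<^sub>i\<close>
  and \<open>Y\<^sub>i\<close>, and real central translations adjust the real part of the central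
  coordinate. Its imaginary part is adjusted by multiplying with \<open>t u\<close> from the right, which
  does not change the coset, and with \<open>- t u\<close> from the left: this shifts the imaginary part by
  \<open>t\<close> times the form of \<open>b\<close> and \<open>u\<close>, which is nonzero by assumption.
\<close>

lemma reflection_in_orbit_if_generic:
  assumes H: "subgroup H real_heis" and center: "axis Zi 1 \<notin> lie_algebra_of H"
    and u: "u \<in> lie_algebra_of H" and x: "x = complexify a + \<i> *s complexify b"
    and generic: "heis_form b u \<noteq> 0"
  shows "hproj H (reflection q x) \<in> orbit_of UNIV (hproj H x)"
proof -
  \<comment> \<open>The values of \<open>t\<close> and \<open>d\<close> solve the equation for the imaginary and the real part of the central coordinate.\<close>
  define t where "t = (heis_form a b - 2 * (q \<bullet> b)) / heis_form b u"
  define d where "d = 2 * (q \<bullet> a)"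
  define g where "g = - 2 *\<^sub>R a - t *\<^sub>R u + d *\<^sub>R axis Zi 1"
  define k where "k = complexify (t *\<^sub>R u)"
  have tu: "t *\<^sub>R u \<in> lie_algebra_of H"
    using u by (rule subspace_scale[OF subspace_lie_algebra[OF H]])
  have "hproj H ((complexify g \<otimes>\<^bsub>complex_heis\<^esub> x) \<otimes>\<^bsub>complex_heis\<^esub> k) =
      hproj H (complexify g \<otimes>\<^bsub>complex_heis\<^esub> x)"
    unfolding k_def
    by (intro hproj_mult_central complexify_in_complex_subgroup tu heis_form_lie_algebra_eq_0[OF H center tu])
  moreover have "(complexify g \<otimes>\<^bsub>complex_heis\<^esub> x) \<otimes>\<^bsub>complex_heis\<^esub> k = reflection q x"
  proof -
    define c where "c = heis_form (complexify g) x / 2 + heis_form (complexify g + x) k / 2"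
    have "(complexify g \<otimes>\<^bsub>complex_heis\<^esub> x) \<otimes>\<^bsub>complex_heis\<^esub> k = (complexify g + x + k) + c *s axis Zi 1"
      by (simp add: heis_mult_eq heis_form_linear vec.scale_left_distrib c_def add.commute add.left_commute)
    also have "complexify g + x + k = - conj_heis x + complex_of_real d *s axis Zi 1"
      by (simp add: x g_def k_def complexify_simps vec_eq_iff)
    also have "c = \<i> * complex_of_real (t * heis_form b u - heis_form a b)"
      by (simp add: c_def x g_def k_def complexify_simps heis_form_linear heis_form_complexify
        heis_form_swap[of u a] heis_form_swap[of u b] field_simps)
    also have "\<dots> = \<i> * complex_of_real (- 2 * (q \<bullet> b))"
      using generic by (simp add: t_def)
    also have "- conj_heis x + complex_of_real d *s axis Zi 1 + \<i> * complex_of_real (- 2 * (q \<bullet> b)) *s axis Zi 1 =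
        - conj_heis x + (complex_of_real d + \<i> * complex_of_real (- 2 * (q \<bullet> b))) *s axis Zi 1"
      by (simp only: vec.scale_left_distrib add.assoc)
    also have "complex_of_real d + \<i> * complex_of_real (- 2 * (q \<bullet> b)) = 2 * functional q (conj_heis x)"
      by (simp add: x d_def algebra_simps)
    finally show ?thesis
      by (simp add: reflection_def)
  qed
  ultimately show ?thesis
    unfolding orbit_of_hproj by (metis UNIV_I image_eqI)
qed

lemma exists_heis_form_nonzero:
  fixes u :: "(real, 'n::finite) heis"
  assumes "u \<noteq> (u $ Zi) *\<^sub>R axis Zi 1"
  shows "\<exists>b. heis_form b u \<noteq> 0"
proof -
  have form: "heis_form (axis (Xi i) 1) u = u $ Yi i" "heis_form (axis (Yi i) 1) u = - u $ Xi i" for i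
    unfolding heis_form_def by (subst sum.remove[of _ i]; auto simp: axis_def intro!: sum.neutral)+
  obtain j where j: "u $ j \<noteq> ((u $ Zi) *\<^sub>R axis Zi 1) $ j"
    using assms by (auto simp: vec_eq_iff)
  show ?thesis
  proof (cases j)
    case (Xi i)
    then show ?thesis
      using j form(2)[of i] by (intro exI[of _ "axis (Yi i) 1"]) (simp add: axis_def)
  next
    case (Yi i)
    then show ?thesis
      using j form(1)[of i] by (intro exI[of _ "axis (Xi i) 1"]) (simp add: axis_def)
  next
    case Zi
    then show ?thesis
      using j by (simp add: axis_def)
  qed
qed

text \<open>
  If the Lie algebra contains the centre, any \<open>q\<close> with \<open>q $ Zi = 1\<close> will do, and
  all orbits are preserved. If not, \<open>q\<close> is taken orthogonal to the Lie algebra, so that the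
  reflection acts on it by \<open>-1\<close>, and the preserved orbits are those of the points whose
  imaginary part is not symplectically orthogonal to a chosen \<open>u \<noteq> 0\<close> in the Lie
  algebra.
\<close>

theorem exists_orbit_preserving_involution:
  fixes H :: "(real, 'n::finite) heis set"
  assumes H: "connected_closed_subgroup H" and nontriv: "H \<noteq> {0}"
  obtains \<sigma> W where "antiholomorphic_map H \<sigma>" "\<sigma> ` hspace H = hspace H" "open W" "W \<noteq> {}"
    "\<And>x. x \<in> W \<Longrightarrow> \<sigma> (hproj H x) \<in> orbit_of UNIV (hproj H x)"
proof -
  have sub: "subgroup H real_heis"
    using H by (simp add: connected_closed_subgroup_def)
  note result = that
  have *: thesis
    if q: "q $ Zi = 1"
      and inv: "\<And>u. u \<in> lie_algebra_of H \<Longrightarrow> reflection q (complexify u) \<in> complex_subgroup H"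
      and W: "open W" "W \<noteq> {}" "\<And>x. x \<in> W \<Longrightarrow> hproj H (reflection q x) \<in> orbit_of UNIV (hproj H x)"
    for q W
  proof -
    have \<sigma>: "reflection q ` hproj H x = hproj H (reflection q x)" for x
      by (intro reflection_image_hproj reflection_image_complex_subgroup q inv)
    have "image (reflection q) ` hspace H = range (\<lambda>x. hproj H (reflection q x))"
      by (simp add: hspace_eq_range image_image \<sigma>)
    also have "\<dots> = hspace H"
      unfolding hspace_eq_range using reflection_involution[OF q] by (metis surjI fun.set_map image_image)
    finally show thesis
      by (intro result[of "image (reflection q)" W] antiholomorphic_map_reflection[of _ _ q]) (simp_all add: \<sigma> W)
  qed
  show thesis
  proof (cases "axis Zi 1 \<in> lie_algebra_of H")
    case True
    then have center: "axis Zi 1 \<in> complex_subgroup H"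
      using complexify_in_complex_subgroup by (fastforce simp: complexify_simps)
    show thesis
    proof (rule *[of "axis Zi 1" UNIV])
      show "reflection (axis Zi 1) (complexify u) \<in> complex_subgroup H" if "u \<in> lie_algebra_of H" for u
        unfolding reflection_def conj_heis_simps
        by (intro vec.subspace_add[OF subspace_complex_subgroup] vec.subspace_neg[OF subspace_complex_subgroup]
          vec.subspace_scale[OF subspace_complex_subgroup] center complexify_in_complex_subgroup that)
    qed (auto intro: reflection_in_orbit_if_center_in_lie_algebra[OF True])
  next
    case False
    have lie: "subspace (lie_algebra_of H)"
      by (rule subspace_lie_algebra[OF sub])
    obtain y z where yz: "axis Zi 1 = y + z" "y \<in> lie_algebra_of H" "\<And>w. w \<in> lie_algebra_of H \<Longrightarrow> orthogonal z w"
      using orthogonal_subspace_decomp_exists[of "lie_algebra_of H" "axis Zi 1"] lie span_eq_iff by metis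
    have "z \<noteq> 0"
      using yz(1,2) False by auto
    moreover have zZ: "z $ Zi = z \<bullet> z"
    proof -
      have "z $ Zi = z \<bullet> axis Zi 1"
        by (simp add: inner_axis)
      also have "\<dots> = z \<bullet> z"
        using yz(3)[OF yz(2)] by (simp add: yz(1) inner_add_right orthogonal_def)
      finally show ?thesis .
    qed
    ultimately have nz: "z $ Zi \<noteq> 0"
      by simp
    define q where "q = (1 / z $ Zi) *\<^sub>R z"
    obtain u where u: "u \<in> lie_algebra_of H" "u \<noteq> 0"
      using lie_algebra_nontrivial[OF H nontriv] by blast
    have "u \<noteq> (u $ Zi) *\<^sub>R axis Zi 1"
    proof
      assume "u = (u $ Zi) *\<^sub>R axis Zi 1"
      then obtain c where eq: "u = c *\<^sub>R axis Zi 1"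
        by blast
      then have "c \<noteq> 0"
        using u(2) by auto
      moreover have "(1 / c) *\<^sub>R u \<in> lie_algebra_of H"
        by (rule subspace_scale[OF lie u(1)])
      ultimately have "axis Zi 1 \<in> lie_algebra_of H"
        by (simp add: eq)
      then show False
        using False by simp
    qed
    then obtain b where b: "heis_form b u \<noteq> 0"
      using exists_heis_form_nonzero by blast
    define ip :: "(complex, 'n) heis \<Rightarrow> (real, 'n) heis" where "ip x = (\<chi> i. Im (x $ i))" for x
    show thesis
    proof (rule *[of q "{x. heis_form (ip x) u \<noteq> 0}"])
      show "q $ Zi = 1"
        using nz by (simp add: q_def)
      show "reflection q (complexify w) \<in> complex_subgroup H" if w: "w \<in> lie_algebra_of H" for w
      proof -
        have "q \<bullet> w = 0"
          using yz(3)[OF w] by (simp add: q_def orthogonal_def)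
        then have "reflection q (complexify w) = - complexify w"
          by (simp add: reflection_def)
        then show ?thesis
          using w by (simp add: vec.subspace_neg[OF subspace_complex_subgroup] complexify_in_complex_subgroup)
      qed
      show "open {x. heis_form (ip x) u \<noteq> 0}"
        unfolding heis_form_def ip_def by (simp, intro open_Collect_neq continuous_intros)
      have "ip (\<i> *s complexify b) = b"
        by (simp add: ip_def complexify_def vec_eq_iff)
      then show "{x. heis_form (ip x) u \<noteq> 0} \<noteq> {}"
        using b by (auto intro!: exI[of _ "\<i> *s complexify b"])
      show "hproj H (reflection q x) \<in> orbit_of UNIV (hproj H x)" if "x \<in> {x. heis_form (ip x) u \<noteq> 0}" for x
      proof (rule reflection_in_orbit_if_generic[OF sub False u(1)])
        show "x = complexify (\<chi> i. Re (x $ i)) + \<i> *s complexify (ip x)"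
          by (simp add: ip_def complexify_def vec_eq_iff complex_eq)
        show "heis_form (ip x) u \<noteq> 0"
          using that by simp
      qed
    qed
  qed
qed

theorem theorem8p1:
  fixes H :: "(real, 'n::finite) heis set"
  assumes "connected_closed_subgroup H"
    and "H \<noteq> {\<one>\<^bsub>real_heis\<^esub>}" and "H \<noteq> carrier real_heis"
  shows "multiplicity_free TYPE('v::complex_hilbert_space) H (carrier real_heis) (hrep H) \<and>
    (\<forall>L. connected_closed_subgroup L \<and> strongly_visible H L \<longrightarrow>
       multiplicity_free TYPE('v) H L (hrep H))"
proof (intro conjI allI impI)
  have "H \<noteq> {0}"
    using assms(2) by simp
  from exists_orbit_preserving_involution[OF assms(1) this]
  show "multiplicity_free TYPE('v) H (carrier real_heis) (hrep H)"
    by (metis carrier_heis_group multiplicity_free_if_orbits_preserved)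
  show "multiplicity_free TYPE('v) H L (hrep H)"
    if "connected_closed_subgroup L \<and> strongly_visible H L" for L
    using that by (simp add: multiplicity_free_if_strongly_visible connected_closed_subgroup_def)
qed

end
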